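(* Let $d\ge 1$, let $(X_i)_{i\geq 1}$ be an i.i.d. sequence of $d$-dimensional random vectors that are centered ($\mathbb{E}[X_1]=0$) with unit covariance matrix ($\mathbb{E}[X_1X_1^T]=I_d$), and let $Z\sim\mathcal N(0,I_d)$. Assume that $\mathbb{E}[|X_1|^3]<\infty$. Then for all $n\geq 3$ (and any $i$, the $X_i$ being identically distributed) $$\mathcal W\left(n^{-1/2}\sum_{i=1}^n X_i,\,Z\right)\leq e\,\frac{C(d)+2(1+d)\log n}{\sqrt n}\;\mathbb{E}|X_i|^3,$$ where $$C(d)=2^{3/2}\,\frac{2d+1}{d}\,\frac{\Gamma\left(\frac{1+d}{2}\right)}{\Gamma(d/2)}+2\sqrt{\frac{2}{\pi}}\,\sqrt d .$$
   Context: $|\cdot|$ is the Euclidean norm on $\mathbb{R}^d$, $\log$ is the natural logarithm, and $\Gamma$ is the Gamma function. $\mathcal W$ is the $1$-Wasserstein distance between the laws of random vectors: $\mathcal W(X,Y)=\sup_{h}\left(\mathbb{E}\,h(X)-\mathbb{E}\,h(Y)\right)$, where the supremum is over all functions $h:\mathbb{R}^d\to\mathbb{R}$ that are Lipschitz with constant $1$ for the Euclidean norm. *)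

theory Defs
  imports "HOL-Probability.Probability"
begin

text \<open>
  The 1-Wasserstein distance of two laws on a metric space, in its dual (Kantorovich-Rubinstein)
  form. It takes values in \<^typ>\<open>ereal\<close>, so that the supremum is always meaningful. The Bochner
  integral is 0 on non-integrable functions, so the definition is only intended for laws with
  finite first moment, for which every Lipschitz function is integrable.
\<close>

definition wasserstein :: "'a::metric_space measure \<Rightarrow> 'a measure \<Rightarrow> ereal" where
  "wasserstein \<mu> \<nu> =
     (SUP h \<in> {h :: 'a \<Rightarrow> real. 1-lipschitz_on UNIV h}. ereal ((\<integral>x. h x \<partial>\<mu>) - (\<integral>x. h x \<partial>\<nu>)))"

definition std_normal_vec_density :: "real ^ 'd \<Rightarrow> real" where
  "std_normal_vec_density x = exp (- (norm x)\<^sup>2 / 2) / (2 * pi) powr (real CARD('d) / 2)"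

definition C_const :: "nat \<Rightarrow> real" where
  "C_const d = 2 powr (3 / 2) * ((2 * real d + 1) / real d)
       * (Gamma ((1 + real d) / 2) / Gamma (real d / 2))
     + 2 * sqrt (2 / pi) * sqrt (real d)"

end

theory Submission imports Defs begin

text \<open>
  Lindeberg's replacement method, in which the Gaussian variables already inserted serve as the
  smoothing. When \<open>k\<close> of the \<open>n\<close> summands are not yet replaced, the test function \<open>h\<close> acts through
  \<open>h\<^sub>\<sigma>(x) = E h(x + \<sigma> Z)\<close> with \<open>\<sigma>\<^sup>2 = (n - k)/n\<close>. By the Cameron-Martin formula the second
  derivative of \<open>h\<^sub>\<sigma>\<close> in direction \<open>y\<close> is
  \<open>E h(x + \<sigma> Z) (\<langle>Z,y\<rangle>\<^sup>2 - |y|\<^sup>2) / \<sigma>\<^sup>2\<close>, which is Lipschitz in \<open>x\<close> with constant \<open>2|y|\<^sup>2/\<sigma>\<^sup>2\<close>.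
  As the first two moments agree, replacing one more summand costs
  \<open>O(n\<^bsup>-3/2\<^esup> E|X|\<^sup>3 / \<sigma>\<^sup>2) = O(n\<^bsup>-1/2\<^esup> E|X|\<^sup>3 / (n - k))\<close>, and the harmonic sum produces the
  logarithm; the one replacement with \<open>\<sigma> = 0\<close> is estimated by first moments. In total this gives
  the bound \<open>8 log n / sqrt n\<close> times the third moment, which lies below the claimed one since
  \<open>8 \<le> 4e\<close> and \<open>C(d) \<ge> 0\<close>.
\<close>

subsection \<open>The standard Gaussian measure\<close>

text \<open>The density is set up over an arbitrary Euclidean space so that coordinates are handled
  through \<open>Basis\<close>; at type \<open>real ^ 'd\<close> it coincides with
  \<open>std_normal_vec_density\<close>.\<close>

definition gauss_density :: "'a::euclidean_space \<Rightarrow> real" where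
  "gauss_density x = exp (- (norm x)\<^sup>2 / 2) / (2 * pi) powr (real DIM('a) / 2)"

definition std_gauss :: "'a::euclidean_space measure" where
  "std_gauss = density lborel (\<lambda>x. ennreal (gauss_density x))"

lemma gauss_density_measurable [measurable]: "gauss_density \<in> borel_measurable borel"
  unfolding gauss_density_def by measurable

lemma gauss_density_nonneg [simp]: "0 \<le> gauss_density x"
  by (simp add: gauss_density_def)

lemma sets_std_gauss [simp, measurable_cong]: "sets std_gauss = sets borel"
  by (simp add: std_gauss_def)

lemma space_std_gauss [simp]: "space std_gauss = UNIV"
  by (simp add: std_gauss_def)

lemma gauss_density_eq_prod:
  "gauss_density (x :: 'a::euclidean_space) = (\<Prod>b\<in>Basis. std_normal_density (x \<bullet> b))"
proof -
  have "(2 * pi) powr (real DIM('a) / 2) = sqrt (2 * pi) ^ DIM('a)"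
    by (simp add: powr_half_sqrt[symmetric] powr_powr flip: powr_realpow)
  moreover have "(norm x)\<^sup>2 = (\<Sum>b\<in>Basis. (x \<bullet> b)\<^sup>2)"
    by (subst euclidean_inner[of x x, folded power2_norm_eq_inner]) (simp add: power2_eq_square)
  ultimately show ?thesis
    by (simp add: gauss_density_def normal_density_def prod_dividef exp_sum sum_divide_distrib
      flip: sum_negf)
qed

text \<open>The Gaussian density factors over the coordinates, so Tonelli splits the integral. Total
  mass, coordinate moments and exponential moments are all reduced to one dimension in this
  way.\<close>

lemma nn_integral_std_gauss_prod:
  fixes f :: "'a::euclidean_space \<Rightarrow> real \<Rightarrow> real"
  assumes [measurable]: "\<And>b. b \<in> Basis \<Longrightarrow> f b \<in> borel_measurable borel"
    and nn: "\<And>b x. b \<in> Basis \<Longrightarrow> 0 \<le> f b x"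
  shows "(\<integral>\<^sup>+z. (\<Prod>b\<in>Basis. f b (z \<bullet> b)) \<partial>std_gauss) =
    (\<Prod>b\<in>Basis. \<integral>\<^sup>+x. ennreal (std_normal_density x * f b x) \<partial>lborel)"
proof -
  have "(\<integral>\<^sup>+z. (\<Prod>b\<in>Basis. f b (z \<bullet> b)) \<partial>std_gauss) =
     (\<integral>\<^sup>+z. (\<Prod>b\<in>Basis. ennreal (std_normal_density (z \<bullet> b) * f b (z \<bullet> b))) \<partial>lborel)"
    unfolding std_gauss_def
    by (subst nn_integral_density)
       (auto simp: gauss_density_eq_prod prod_ennreal nn prod_nonneg ennreal_mult' prod.distrib
          intro!: nn_integral_cong simp flip: ennreal_mult')
  also have "\<dots> = (\<Prod>b\<in>Basis. \<integral>\<^sup>+x. ennreal (std_normal_density x * f b x) \<partial>lborel)"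
    by (rule nn_integral_lborel_prod) (auto simp: nn)
  finally show ?thesis .
qed

lemma nn_integral_std_normal: "(\<integral>\<^sup>+x. ennreal (std_normal_density x) \<partial>lborel) = 1"
  using prob_space.emeasure_space_1[OF prob_space_normal_density[of 1 0]]
  by (simp add: emeasure_density)

lemma prob_space_std_gauss: "prob_space (std_gauss :: 'a::euclidean_space measure)"
proof
  have "emeasure std_gauss (space std_gauss :: 'a set) = (\<integral>\<^sup>+z. 1 \<partial>(std_gauss :: 'a measure))" by simp
  also have "\<dots> = 1"
    using nn_integral_std_gauss_prod[of "\<lambda>_::'a. \<lambda>_. 1"]
    by (simp add: nn_integral_std_normal)
  finally show "emeasure std_gauss (space std_gauss :: 'a set) = 1" .
qed

interpretation std_gauss: prob_space std_gauss
  by (rule prob_space_std_gauss)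

text \<open>The monomial is a product over the basis in which every factor except the one at
  \<open>b\<close> is 1; the remaining factor is a one-dimensional even moment. The fourth moment,
  \<open>k = 2\<close>, later controls the third moment of the norm.\<close>

lemma std_gauss_moment_coordinate:
  fixes b :: "'a::euclidean_space"
  assumes b: "b \<in> Basis"
  shows "has_bochner_integral std_gauss (\<lambda>z. (z \<bullet> b) ^ (2 * k)) (fact (2 * k) / (2 ^ k * fact k))"
proof (rule has_bochner_integral_nn_integral)
  have "(\<integral>\<^sup>+z. ennreal ((z \<bullet> b) ^ (2 * k)) \<partial>std_gauss) =
    (\<integral>\<^sup>+z. (\<Prod>c\<in>Basis. (if c = b then (z \<bullet> c) ^ (2 * k) else 1)) \<partial>std_gauss)"
    using b by (simp add: prod.delta)
  also have "\<dots> = (\<Prod>c\<in>(Basis::'a set). \<integral>\<^sup>+x. ennreal (std_normal_density x *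
      (if c = b then x ^ (2 * k) else 1)) \<partial>lborel)"
    by (subst nn_integral_std_gauss_prod[of "\<lambda>c x. if c = b then x ^ (2 * k) else 1"]) auto
  also have "\<dots> = (\<Prod>c\<in>(Basis::'a set). if c = b then 
      (\<integral>\<^sup>+x. ennreal (std_normal_density x * x ^ (2 * k)) \<partial>lborel) else 1)"
    by (intro prod.cong refl) (simp add: nn_integral_std_normal)
  also have "\<dots> = (\<integral>\<^sup>+x. ennreal (std_normal_density x * x ^ (2 * k)) \<partial>lborel)"
    using b by (simp add: prod.delta)
  also have "\<dots> = ennreal (fact (2 * k) / (2 ^ k * fact k))"
    using std_normal_moment_even[of k]
    by (subst nn_integral_eq_integral) (auto simp: has_bochner_integral_iff)
  finally show "(\<integral>\<^sup>+z. ennreal ((z \<bullet> b) ^ (2 * k)) \<partial>std_gauss) =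
    ennreal (fact (2 * k) / (2 ^ k * fact k))" .
qed auto

text \<open>The linear exponent is absorbed by a quarter of the squared norm, and the exponential of
  the latter factors over the coordinates. Each factor stays finite because a quarter is less than
  the half in the Gaussian exponent.\<close>

lemma std_gauss_exp_norm_integrable:
  "integrable std_gauss (\<lambda>z::'a::euclidean_space. exp (c * norm z))"
proof (rule integrableI_bounded)
  have fin: "(\<integral>\<^sup>+x. ennreal (std_normal_density x * exp (x\<^sup>2 / 4)) \<partial>lborel) < \<infinity>"
  proof -
    \<comment> \<open>What remains of the exponent is -x^2/4, the exponent of the normal density
      with variance 2.\<close>
    have "std_normal_density x * exp (x\<^sup>2 / 4) = sqrt 2 * normal_density 0 (sqrt 2) x" for x
      by (simp add: normal_density_def real_sqrt_mult field_simps flip: exp_add)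
    then have "(\<integral>\<^sup>+x. ennreal (std_normal_density x * exp (x\<^sup>2 / 4)) \<partial>lborel) =
        ennreal (sqrt 2) * (\<integral>\<^sup>+x. normal_density 0 (sqrt 2) x \<partial>lborel)"
      by (subst nn_integral_cmult[symmetric]) (auto simp: ennreal_mult')
    also have "(\<integral>\<^sup>+x. normal_density 0 (sqrt 2) x \<partial>lborel) = 1"
      using prob_space.emeasure_space_1[OF prob_space_normal_density[of "sqrt 2" 0]]
      by (simp add: emeasure_density)
    finally show ?thesis by simp
  qed
  have "exp (c * norm z) \<le> exp (c\<^sup>2) * (\<Prod>b\<in>Basis. exp ((z \<bullet> b)\<^sup>2 / 4))" for z :: 'a
  proof -
    have "c * norm z \<le> c\<^sup>2 + (norm z)\<^sup>2 / 4"
      using zero_le_power2[of "c - norm z / 2"] by (simp add: power2_eq_square algebra_simps)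
    moreover have "(norm z)\<^sup>2 = (\<Sum>b\<in>Basis. (z \<bullet> b)\<^sup>2)"
      by (subst euclidean_inner[of z z, folded power2_norm_eq_inner]) (simp add: power2_eq_square)
    ultimately show ?thesis
      by (simp flip: exp_sum exp_add sum_divide_distrib)
  qed
  then have "(\<integral>\<^sup>+z. ennreal (norm (exp (c * norm (z::'a)))) \<partial>std_gauss) \<le>
      (\<integral>\<^sup>+z. ennreal (exp (c\<^sup>2)) * ennreal (\<Prod>b\<in>Basis. exp ((z \<bullet> b)\<^sup>2 / 4)) \<partial>(std_gauss :: 'a measure))"
    by (intro nn_integral_mono) (simp add: ennreal_leI flip: ennreal_mult')
  also have "\<dots> = ennreal (exp (c\<^sup>2)) *
      (\<Prod>b\<in>(Basis::'a set). \<integral>\<^sup>+x. ennreal (std_normal_density x * exp (x\<^sup>2 / 4)) \<partial>lborel)"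
    by (simp add: nn_integral_cmult nn_integral_std_gauss_prod[of "\<lambda>_ x. exp (x\<^sup>2 / 4)"])
  also have "\<dots> < \<infinity>"
    using fin by (simp add: ennreal_mult_less_top power_less_top_ennreal)
  finally show "(\<integral>\<^sup>+z. ennreal (norm (exp (c * norm (z::'a)))) \<partial>std_gauss) < \<infinity>" .
qed simp

lemma integral_std_gauss:
  fixes f :: "'a::euclidean_space \<Rightarrow> real"
  assumes [measurable]: "f \<in> borel_measurable borel"
  shows "(\<integral>z. f z \<partial>std_gauss) = (\<integral>z. gauss_density z * f z \<partial>lborel)"
  unfolding std_gauss_def by (subst integral_density) auto

text \<open>The exponential is the ratio of the Gaussian density centred at \<open>w\<close> to the
  one centred at 0, so translating Lebesgue measure by \<open>w\<close> removes it. This trades a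
  shift in the argument of \<open>f\<close> for a smooth weight, which can be differentiated in
  \<open>w\<close> even when \<open>f\<close> cannot.\<close>

lemma std_gauss_cameron_martin:
  fixes f :: "'a::euclidean_space \<Rightarrow> real"
  assumes [measurable]: "f \<in> borel_measurable borel"
  shows "(\<integral>z. f z * exp (z \<bullet> w - (norm w)\<^sup>2 / 2) \<partial>std_gauss) = (\<integral>z. f (w + z) \<partial>std_gauss)"
proof -
  have *: "gauss_density (w + z) * exp ((w + z) \<bullet> w - (norm w)\<^sup>2 / 2) = gauss_density z" for z :: 'a
    by (simp add: gauss_density_def power2_norm_eq_inner inner_add_left inner_add_right
      inner_commute field_simps flip: exp_add)
  have "(\<integral>z. f z * exp (z \<bullet> w - (norm w)\<^sup>2 / 2) \<partial>std_gauss) =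
      (\<integral>z. gauss_density z * (f z * exp (z \<bullet> w - (norm w)\<^sup>2 / 2)) \<partial>distr lborel borel ((+) w))"
    by (subst integral_std_gauss) (auto simp: lborel_distr_plus)
  also have "\<dots> = (\<integral>z. f (w + z) * (gauss_density (w + z) * exp ((w + z) \<bullet> w - (norm w)\<^sup>2 / 2)) \<partial>lborel)"
    by (subst integral_distr) (auto simp: mult_ac)
  also have "\<dots> = (\<integral>z. f (w + z) \<partial>std_gauss)"
    unfolding * by (subst integral_std_gauss) (auto simp: mult_ac)
  finally show ?thesis .
qed

text \<open>With u = a z + b w in place of w, the joint density of (z, u) turns out to be symmetric
  in z and u. Integrating out z therefore leaves the same marginal for u as integrating out u leaves
  for z, namely the Gaussian.\<close>

lemma std_gauss_convolution:
  fixes a b :: real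
  assumes ab: "a\<^sup>2 + b\<^sup>2 = 1" and b: "0 < b"
  shows "distr (std_gauss \<Otimes>\<^sub>M std_gauss) borel (\<lambda>(z, w). a *\<^sub>R z + b *\<^sub>R w) =
    (std_gauss :: 'a::euclidean_space measure)"
proof (rule measure_eqI)
  fix A :: "'a set"
  assume "A \<in> sets (distr (std_gauss \<Otimes>\<^sub>M std_gauss) borel (\<lambda>(z, w). a *\<^sub>R z + b *\<^sub>R w))"
  then have [measurable]: "A \<in> sets borel" by simp
  \<comment> \<open>The Jacobian of the substitution w = (u - c) / b.\<close>
  define k where "k = inverse b ^ DIM('a)"
  have k: "0 \<le> k" using b by (simp add: k_def)
  have scale: "(\<integral>\<^sup>+w. f w \<partial>lborel) = (\<integral>\<^sup>+u. ennreal k * f ((u - c) /\<^sub>R b) \<partial>lborel)"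
    if [measurable]: "f \<in> borel_measurable borel" for f :: "'a \<Rightarrow> ennreal" and c
  proof -
    have "(\<integral>\<^sup>+w. f w \<partial>lborel) = (\<integral>\<^sup>+w. f w
        \<partial>density (distr lborel borel (\<lambda>u. - (c /\<^sub>R b) + inverse b *\<^sub>R u)) (\<lambda>_. \<bar>inverse b\<bar> ^ DIM('a)))"
      using b by (subst lborel_affine[of "inverse b" "- (c /\<^sub>R b)"]) auto
    also have "\<dots> = (\<integral>\<^sup>+u. ennreal k * f (- (c /\<^sub>R b) + inverse b *\<^sub>R u) \<partial>lborel)"
      using b by (simp add: nn_integral_density nn_integral_distr k_def)
    finally show ?thesis by (simp add: scaleR_diff_right)
  qed
  \<comment> \<open>The symmetry in z and u: both exponents agree because b^2 = 1 - a^2.\<close>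
  have dens: "gauss_density z * gauss_density ((u - a *\<^sub>R z) /\<^sub>R b) =
      gauss_density u * gauss_density ((z - a *\<^sub>R u) /\<^sub>R b)" for z u :: 'a
  proof -
    have "b\<^sup>2 * (norm z)\<^sup>2 + (norm (u - a *\<^sub>R z))\<^sup>2 = b\<^sup>2 * (norm u)\<^sup>2 + (norm (z - a *\<^sub>R u))\<^sup>2"
    proof -
      have b2: "b\<^sup>2 = 1 - a\<^sup>2" using ab by simp
      show ?thesis
        unfolding b2 power2_norm_eq_inner
        by (simp add: inner_diff_left inner_diff_right inner_commute algebra_simps power2_eq_square)
    qed
    moreover have "(norm (x /\<^sub>R b))\<^sup>2 = (norm x)\<^sup>2 / b\<^sup>2" for x :: 'a
      by (simp add: power_mult_distrib power_inverse divide_inverse mult.commute)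
    ultimately have "(norm z)\<^sup>2 + (norm ((u - a *\<^sub>R z) /\<^sub>R b))\<^sup>2 = (norm u)\<^sup>2 + (norm ((z - a *\<^sub>R u) /\<^sub>R b))\<^sup>2"
      using b by (simp only:) (simp add: field_simps)
    then show ?thesis
      by (simp add: gauss_density_def field_simps flip: exp_add)
  qed
  have inner: "(\<integral>\<^sup>+w. ennreal (gauss_density w) * indicator A (a *\<^sub>R z + b *\<^sub>R w) \<partial>lborel) =
      (\<integral>\<^sup>+u. ennreal k * (ennreal (gauss_density ((u - a *\<^sub>R z) /\<^sub>R b)) * indicator A u) \<partial>lborel)"
    for z :: 'a
    using b by (subst scale[where c = "a *\<^sub>R z" and
      f = "\<lambda>w. ennreal (gauss_density w) * indicator A (a *\<^sub>R z + b *\<^sub>R w)"]) auto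
  \<comment> \<open>The same substitution read backwards, now in z with u fixed: the conditional
    density of z has the total mass of the Gaussian.\<close>
  have outer: "(\<integral>\<^sup>+z. ennreal k * ennreal (gauss_density ((z - a *\<^sub>R u) /\<^sub>R b)) \<partial>lborel) =
      (\<integral>\<^sup>+z. ennreal (gauss_density z) \<partial>(lborel :: 'a measure))" for u :: 'a
    using scale[of "\<lambda>z. ennreal (gauss_density z)" "a *\<^sub>R u"] by simp
  have "emeasure (distr (std_gauss \<Otimes>\<^sub>M std_gauss) borel (\<lambda>(z, w). a *\<^sub>R z + b *\<^sub>R w)) A =
    (\<integral>\<^sup>+x. indicator A x \<partial>distr (std_gauss \<Otimes>\<^sub>M std_gauss) borel (\<lambda>(z, w). a *\<^sub>R z + b *\<^sub>R w))"
    by simp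
  also have "\<dots> = (\<integral>\<^sup>+p. indicator A (a *\<^sub>R fst p + b *\<^sub>R snd p) \<partial>(std_gauss \<Otimes>\<^sub>M std_gauss))"
    by (subst nn_integral_distr) (auto simp: split_def)
  also have "\<dots> = (\<integral>\<^sup>+z. \<integral>\<^sup>+w. indicator A (a *\<^sub>R z + b *\<^sub>R w) \<partial>std_gauss \<partial>std_gauss)"
    by (subst std_gauss.nn_integral_fst[symmetric]) auto
  also have "\<dots> = (\<integral>\<^sup>+z. ennreal (gauss_density z) *
      (\<integral>\<^sup>+w. ennreal (gauss_density w) * indicator A (a *\<^sub>R z + b *\<^sub>R w) \<partial>lborel) \<partial>lborel)"
    by (simp add: std_gauss_def nn_integral_density)
  also have "\<dots> = (\<integral>\<^sup>+z. ennreal (gauss_density z) * (\<integral>\<^sup>+u. ennreal k *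
      (ennreal (gauss_density ((u - a *\<^sub>R z) /\<^sub>R b)) * indicator A u) \<partial>lborel) \<partial>lborel)"
    by (simp only: inner)
  also have "\<dots> = (\<integral>\<^sup>+z. \<integral>\<^sup>+u. ennreal (gauss_density z) * (ennreal k *
      (ennreal (gauss_density ((u - a *\<^sub>R z) /\<^sub>R b)) * indicator A u)) \<partial>lborel \<partial>lborel)"
    by (subst nn_integral_cmult) auto
  also have "\<dots> = (\<integral>\<^sup>+u. \<integral>\<^sup>+z. ennreal (gauss_density z) * (ennreal k *
      (ennreal (gauss_density ((u - a *\<^sub>R z) /\<^sub>R b)) * indicator A u)) \<partial>lborel \<partial>lborel)"
    by (rule lborel_pair.Fubini') (simp add: split_def)
  also have "\<dots> = (\<integral>\<^sup>+u. \<integral>\<^sup>+z. ennreal (gauss_density u) * indicator A u * (ennreal k *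
      ennreal (gauss_density ((z - a *\<^sub>R u) /\<^sub>R b))) \<partial>lborel \<partial>lborel)"
  proof (intro nn_integral_cong)
    fix u z :: 'a
    have swap: "ennreal (gauss_density z) * ennreal (gauss_density ((u - a *\<^sub>R z) /\<^sub>R b)) =
      ennreal (gauss_density u) * ennreal (gauss_density ((z - a *\<^sub>R u) /\<^sub>R b))"
      by (simp add: dens flip: ennreal_mult)
    have "ennreal (gauss_density z) * (ennreal k *
      (ennreal (gauss_density ((u - a *\<^sub>R z) /\<^sub>R b)) * indicator A u)) =
      (ennreal (gauss_density z) * ennreal (gauss_density ((u - a *\<^sub>R z) /\<^sub>R b))) *
      (ennreal k * indicator A u)"
      by (simp only: mult_ac)
    then show "ennreal (gauss_density z) * (ennreal k *
      (ennreal (gauss_density ((u - a *\<^sub>R z) /\<^sub>R b)) * indicator A u)) =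
      ennreal (gauss_density u) * indicator A u * (ennreal k * ennreal (gauss_density ((z - a *\<^sub>R u) /\<^sub>R b)))"
      unfolding swap by (simp only: mult_ac)
  qed
  also have "\<dots> = (\<integral>\<^sup>+u. ennreal (gauss_density u) * indicator A u *
      (\<integral>\<^sup>+z. ennreal k * ennreal (gauss_density ((z - a *\<^sub>R u) /\<^sub>R b)) \<partial>lborel) \<partial>lborel)"
    by (subst nn_integral_cmult) auto
  also have "\<dots> = (\<integral>\<^sup>+u. ennreal (gauss_density u) * indicator A u *
      (\<integral>\<^sup>+z. ennreal (gauss_density z) \<partial>(lborel :: 'a measure)) \<partial>lborel)"
    by (simp only: outer)
  also have "(\<integral>\<^sup>+z. ennreal (gauss_density z) \<partial>(lborel :: 'a measure)) = 1"
    using std_gauss.emeasure_space_1 by (simp add: std_gauss_def emeasure_density)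
  also have "(\<integral>\<^sup>+u. ennreal (gauss_density u) * indicator A u * 1 \<partial>lborel) = emeasure std_gauss A"
    by (simp add: std_gauss_def emeasure_density)
  finally show "emeasure (distr (std_gauss \<Otimes>\<^sub>M std_gauss) borel (\<lambda>(z, w). a *\<^sub>R z + b *\<^sub>R w)) A =
    emeasure std_gauss A" .
qed simp

section \<open>Functions of at most exponential growth\<close>

definition exp_bounded :: "('a::real_normed_vector \<Rightarrow> real) \<Rightarrow> bool" where
  "exp_bounded f \<longleftrightarrow> (\<exists>K\<ge>0. \<exists>c\<ge>0. \<forall>z. \<bar>f z\<bar> \<le> K * exp (c * norm z))"

lemma exp_boundedI:
  assumes "\<And>z. \<bar>f z\<bar> \<le> K * exp (c * norm z)" "0 \<le> c"
  shows "exp_bounded f"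
proof -
  have "0 \<le> K" using order_trans[OF abs_ge_zero assms(1)[of 0]] by simp
  with assms show ?thesis unfolding exp_bounded_def by blast
qed

lemma exp_bounded_mono:
  assumes "exp_bounded g" "\<And>z. \<bar>f z\<bar> \<le> \<bar>g z\<bar>"
  shows "exp_bounded f"
  using assms unfolding exp_bounded_def by (meson order_trans)

lemma exp_bounded_const: "exp_bounded (\<lambda>_. c)"
  by (rule exp_boundedI[of _ "\<bar>c\<bar>" 0]) auto

lemma exp_bounded_norm: "exp_bounded norm"
proof (rule exp_boundedI[of _ 1 1])
  show "\<bar>norm z\<bar> \<le> 1 * exp (1 * norm z)" for z :: 'a
    using exp_ge_add_one_self[of "norm z"] norm_ge_zero[of z]
    unfolding abs_norm_cancel mult_1 by linarith
qed simp

lemma exp_bounded_exp: "exp_bounded (\<lambda>z. exp (c * norm z))"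
  by (rule exp_boundedI[of _ 1 "\<bar>c\<bar>"]) (auto intro: mult_right_mono)

lemma exp_bounded_add:
  assumes "exp_bounded f" "exp_bounded g"
  shows "exp_bounded (\<lambda>z. f z + g z)"
proof -
  obtain K c where f: "0 \<le> K" "0 \<le> c" "\<And>z. \<bar>f z\<bar> \<le> K * exp (c * norm z)"
    using assms(1) unfolding exp_bounded_def by blast
  obtain L d where g: "0 \<le> L" "0 \<le> d" "\<And>z. \<bar>g z\<bar> \<le> L * exp (d * norm z)"
    using assms(2) unfolding exp_bounded_def by blast
  show ?thesis
  proof (rule exp_boundedI[of _ "K + L" "c + d"])
    fix z :: 'a
    have "K * exp (c * norm z) \<le> K * exp ((c + d) * norm z)"
      "L * exp (d * norm z) \<le> L * exp ((c + d) * norm z)"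
      using f(1,2) g(1,2) by (auto intro!: mult_left_mono mult_right_mono)
    then show "\<bar>f z + g z\<bar> \<le> (K + L) * exp ((c + d) * norm z)"
      using f(3)[of z] g(3)[of z] unfolding distrib_right[of K L] by linarith
  qed (use f g in auto)
qed

lemma exp_bounded_mult:
  assumes "exp_bounded f" "exp_bounded g"
  shows "exp_bounded (\<lambda>z. f z * g z)"
proof -
  obtain K c where f: "0 \<le> K" "0 \<le> c" "\<And>z. \<bar>f z\<bar> \<le> K * exp (c * norm z)"
    using assms(1) unfolding exp_bounded_def by blast
  obtain L d where g: "0 \<le> L" "0 \<le> d" "\<And>z. \<bar>g z\<bar> \<le> L * exp (d * norm z)"
    using assms(2) unfolding exp_bounded_def by blast
  show ?thesis
  proof (rule exp_boundedI[of _ "K * L" "c + d"])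
    fix z :: 'a
    have "\<bar>f z * g z\<bar> \<le> (K * exp (c * norm z)) * (L * exp (d * norm z))"
      unfolding abs_mult by (intro mult_mono f g) (use f in auto)
    then show "\<bar>f z * g z\<bar> \<le> (K * L) * exp ((c + d) * norm z)"
      unfolding distrib_right exp_add by (simp only: mult_ac)
  qed (use f g in auto)
qed

lemma exp_bounded_diff:
  assumes "exp_bounded f" "exp_bounded g"
  shows "exp_bounded (\<lambda>z. f z - g z)"
  using exp_bounded_add[OF assms(1) exp_bounded_mult[OF exp_bounded_const[of "-1"] assms(2)]]
  by simp

lemma exp_bounded_power: "exp_bounded f \<Longrightarrow> exp_bounded (\<lambda>z. f z ^ n)"
  by (induction n) (auto intro: exp_bounded_const exp_bounded_mult)

lemma exp_bounded_abs: "exp_bounded f \<Longrightarrow> exp_bounded (\<lambda>z. \<bar>f z\<bar>)"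
  by (rule exp_bounded_mono) auto

lemma exp_bounded_inner: "exp_bounded (\<lambda>z. z \<bullet> v)"
  by (rule exp_bounded_mono[OF exp_bounded_mult[OF exp_bounded_norm exp_bounded_const[of "norm v"]]])
     (simp add: Cauchy_Schwarz_ineq2 abs_mult)

lemma exp_bounded_lipschitz:
  assumes "L-lipschitz_on UNIV h"
  shows "exp_bounded (\<lambda>z. h (x + s *\<^sub>R z) :: real)"
proof (rule exp_bounded_mono)
  show "exp_bounded (\<lambda>z. \<bar>h x\<bar> + (L * \<bar>s\<bar>) * norm z)"
    by (intro exp_bounded_add exp_bounded_mult exp_bounded_const exp_bounded_norm)
  show "\<bar>h (x + s *\<^sub>R z)\<bar> \<le> \<bar>\<bar>h x\<bar> + L * \<bar>s\<bar> * norm z\<bar>" for z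
    using lipschitz_on_normD[OF assms, of "x + s *\<^sub>R z" x] by (simp add: mult.assoc)
qed

text \<open>The class contains polynomials in the norm and in inner products as well as the
  exponential weights, and it is closed under products. Integrability against the Gaussian thus
  becomes a syntactic check, together with \<open>exp_bounded_lipschitz\<close> for the test
  functions.\<close>

lemmas exp_bounded_intros = exp_bounded_const exp_bounded_norm exp_bounded_exp exp_bounded_add
  exp_bounded_mult exp_bounded_diff exp_bounded_power exp_bounded_abs exp_bounded_inner

lemma exp_bounded_integrable_std_gauss:
  fixes f :: "'a::euclidean_space \<Rightarrow> real"
  assumes "exp_bounded f" "f \<in> borel_measurable borel"
  shows "integrable std_gauss f"
proof -
  obtain K c where f: "\<And>z. \<bar>f z\<bar> \<le> K * exp (c * norm z)"
    using assms(1) unfolding exp_bounded_def by blast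
  show ?thesis
  proof (rule Bochner_Integration.integrable_bound)
    show "integrable std_gauss (\<lambda>z::'a. K * exp (c * norm z))"
      by (intro integrable_mult_right std_gauss_exp_norm_integrable)
    show "AE z in std_gauss. norm (f z) \<le> norm (K * exp (c * norm z))"
      using f by (intro AE_I2) (metis abs_ge_self order_trans real_norm_def)
  qed (use assms in simp)
qed

subsection \<open>Differentiation of Gaussian integrals along a shift\<close>

text \<open>The mean value inequality bounds all difference quotients by \<open>D\<close>, and
  dominated convergence is applied along each sequence tending to \<open>s\<close>.\<close>

lemma has_real_derivative_integral:
  fixes f f' :: "real \<Rightarrow> 'a \<Rightarrow> real"
  assumes s: "s \<in> {a<..<b}"
    and f: "\<And>t. t \<in> {a<..<b} \<Longrightarrow> integrable M (f t)"
    and f': "f' s \<in> borel_measurable M"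
    and D: "integrable M D"
    and deriv: "\<And>t z. t \<in> {a<..<b} \<Longrightarrow> ((\<lambda>t. f t z) has_real_derivative f' t z) (at t)"
    and bound: "\<And>t z. t \<in> {a<..<b} \<Longrightarrow> \<bar>f' t z\<bar> \<le> D z"
  shows "((\<lambda>t. \<integral>z. f t z \<partial>M) has_real_derivative (\<integral>z. f' s z \<partial>M)) (at s)"
  unfolding has_field_derivative_iff tendsto_at_iff_sequentially
proof (intro allI impI)
  fix X :: "nat \<Rightarrow> real"
  assume X: "\<forall>i. X i \<in> UNIV - {s}" "X \<longlonglongrightarrow> s"
  have "eventually (\<lambda>n. X n \<in> {a<..<b}) sequentially"
    by (rule topological_tendstoD[OF X(2)]) (use s in auto)
  then obtain N where N: "\<And>n. N \<le> n \<Longrightarrow> X n \<in> {a<..<b}"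
    by (auto simp: eventually_sequentially)
  have mvt: "\<bar>(f t z - f s z) / (t - s)\<bar> \<le> D z" if t: "t \<in> {a<..<b}" "t \<noteq> s" for t z
  proof -
    have "convex {a<..<b}" by (simp add: convex_real_interval)
    then have "\<bar>f t z - f s z\<bar> \<le> D z * \<bar>t - s\<bar>"
      using field_differentiable_bound[of "{a<..<b}" "\<lambda>t. f t z" "\<lambda>t. f' t z" "D z" t s]
        deriv bound s t by (auto intro: has_field_derivative_at_within)
    with t show ?thesis by (simp add: abs_divide divide_le_eq)
  qed
  \<comment> \<open>The sequence lies in the interval, where the domination holds, only from index
    \<open>N\<close> on; the shift is undone at the end by \<open>LIMSEQ_offset\<close>.\<close>
  have "(\<lambda>n. \<integral>z. (f (X (n + N)) z - f s z) / (X (n + N) - s) \<partial>M) \<longlonglongrightarrow> (\<integral>z. f' s z \<partial>M)"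
  proof (rule integral_dominated_convergence[where w = D])
    show "(\<lambda>z. (f (X (n + N)) z - f s z) / (X (n + N) - s)) \<in> borel_measurable M" for n
      using f[OF N[of "n + N"]] f[OF s] by auto
    show "AE z in M. norm ((f (X (n + N)) z - f s z) / (X (n + N) - s)) \<le> D z" for n
      using mvt[OF N[of "n + N"]] X(1) by simp
    show "AE z in M. (\<lambda>n. (f (X (n + N)) z - f s z) / (X (n + N) - s)) \<longlonglongrightarrow> f' s z"
    proof (rule AE_I2)
      fix z
      have "((\<lambda>t. (f t z - f s z) / (t - s)) \<longlongrightarrow> f' s z) (at s)"
        using deriv[OF s, of z] by (simp add: has_field_derivative_iff)
      then have "((\<lambda>t. (f t z - f s z) / (t - s)) \<circ> X) \<longlonglongrightarrow> f' s z"
        using X by (simp add: tendsto_at_iff_sequentially)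
      from LIMSEQ_ignore_initial_segment[OF this, of N]
      show "(\<lambda>n. (f (X (n + N)) z - f s z) / (X (n + N) - s)) \<longlonglongrightarrow> f' s z" by (simp add: o_def)
    qed
  qed (use f' D in auto)
  also have "(\<lambda>n. \<integral>z. (f (X (n + N)) z - f s z) / (X (n + N) - s) \<partial>M) =
      (\<lambda>n. ((\<integral>z. f (X (n + N)) z \<partial>M) - (\<integral>z. f s z \<partial>M)) / (X (n + N) - s))"
    by (intro ext, subst Bochner_Integration.integral_diff[symmetric])
       (use f N s in auto)
  finally show "((\<lambda>t. ((\<integral>z. f t z \<partial>M) - (\<integral>z. f s z \<partial>M)) / (t - s)) \<circ> X) \<longlonglongrightarrow> (\<integral>z. f' s z \<partial>M)"
    by (auto simp: o_def intro: LIMSEQ_offset[of _ N])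
qed

text \<open>The parameter occurs only in the tilt and in polynomial factors, so no smoothness of
  \<open>k\<close> enters. Each differentiation of \<open>E\<close> produces a factor
  \<open>z \<bullet> v - s * (norm v)\<^sup>2\<close>, and differentiating that factor itself gives
  the term \<open>- (norm v)\<^sup>2\<close>.\<close>

lemma std_gauss_tilt_derivatives:
  fixes k :: "'a::euclidean_space \<Rightarrow> real" and v :: 'a
  assumes k: "exp_bounded k" and [measurable]: "k \<in> borel_measurable borel"
  defines "E \<equiv> \<lambda>s z. exp (s * (z \<bullet> v) - s\<^sup>2 * (norm v)\<^sup>2 / 2)"
  shows "((\<lambda>s. \<integral>z. k z * E s z \<partial>std_gauss) has_real_derivative
      (\<integral>z. k z * (z \<bullet> v - s * (norm v)\<^sup>2) * E s z \<partial>std_gauss)) (at s)" (is ?A)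
    and "((\<lambda>s. \<integral>z. k z * (z \<bullet> v - s * (norm v)\<^sup>2) * E s z \<partial>std_gauss) has_real_derivative
      (\<integral>z. k z * ((z \<bullet> v - s * (norm v)\<^sup>2)\<^sup>2 - (norm v)\<^sup>2) * E s z \<partial>std_gauss)) (at s)" (is ?B)
proof -
  \<comment> \<open>Domination is required on a neighbourhood of \<open>s\<close>. On {-R<..<R} the
    linear factor is bounded by \<open>l\<close>, and the tilt by \<open>e\<close> after its
    nonpositive quadratic exponent is dropped.\<close>
  define R where "R = \<bar>s\<bar> + 1"
  have s: "s \<in> {-R<..<R}" and R: "0 \<le> R" by (auto simp: R_def)
  define l where "l z = norm z * norm v + R * (norm v)\<^sup>2" for z :: 'a
  define e where "e z = exp ((R * norm v) * norm z)" for z :: 'a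
  have [measurable]: "E t \<in> borel_measurable borel" "l \<in> borel_measurable borel" "e \<in> borel_measurable borel" for t
    unfolding E_def[abs_def] l_def[abs_def] e_def[abs_def] by measurable
  have lin: "\<bar>z \<bullet> v - t * (norm v)\<^sup>2\<bar> \<le> l z" if "t \<in> {-R<..<R}" for t z
  proof -
    have "\<bar>t * (norm v)\<^sup>2\<bar> \<le> R * (norm v)\<^sup>2" using that by (auto simp: abs_mult intro!: mult_right_mono)
    then show ?thesis using Cauchy_Schwarz_ineq2[of z v] unfolding l_def by linarith
  qed
  have E: "0 \<le> E t z" "E t z \<le> e z" if "t \<in> {-R<..<R}" for t z
  proof -
    have "t * (z \<bullet> v) \<le> \<bar>t\<bar> * \<bar>z \<bullet> v\<bar>" by (metis abs_ge_self abs_mult)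
    also have "\<dots> \<le> R * (norm z * norm v)"
      using that R by (intro mult_mono Cauchy_Schwarz_ineq2) auto
    also have "\<dots> = R * norm v * norm z" by (simp add: mult_ac)
    moreover have "0 \<le> t\<^sup>2 * (norm v)\<^sup>2" by simp
    ultimately have "t * (z \<bullet> v) - t\<^sup>2 * (norm v)\<^sup>2 / 2 \<le> R * norm v * norm z" by linarith
    then show "0 \<le> E t z" "E t z \<le> e z" unfolding E_def e_def by auto
  qed
  have l: "exp_bounded l" unfolding l_def
    by (intro exp_bounded_intros)
  have e: "exp_bounded e" unfolding e_def
    by (intro exp_bounded_intros)
  have Eb: "exp_bounded (E t)" if "t \<in> {-R<..<R}" for t
    by (rule exp_bounded_mono[OF e]) (use E[OF that] in \<open>simp add: e_def\<close>)
  have D0: "((\<lambda>s. E s z) has_real_derivative (z \<bullet> v - t * (norm v)\<^sup>2) * E t z) (at t)" for t z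
    unfolding E_def by (auto intro!: derivative_eq_intros)
  show ?A
  proof (rule has_real_derivative_integral[OF s, where D = "\<lambda>z. \<bar>k z\<bar> * l z * e z"])
    show "integrable std_gauss (\<lambda>z. k z * E t z)" if "t \<in> {-R<..<R}" for t
      by (intro exp_bounded_integrable_std_gauss exp_bounded_intros k Eb that) measurable
    show "integrable std_gauss (\<lambda>z. \<bar>k z\<bar> * l z * e z)"
      by (intro exp_bounded_integrable_std_gauss exp_bounded_intros k l e) measurable
    show "((\<lambda>s. k z * E s z) has_real_derivative k z * (z \<bullet> v - t * (norm v)\<^sup>2) * E t z) (at t)" for t z
      using DERIV_cmult[OF D0, of "k z" z t] by (simp add: mult.assoc)
    show "\<bar>k z * (z \<bullet> v - t * (norm v)\<^sup>2) * E t z\<bar> \<le> \<bar>k z\<bar> * l z * e z" if "t \<in> {-R<..<R}" for t z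
    proof -
      have "0 \<le> l z" using lin[OF that, of z] by linarith
      then show ?thesis
        unfolding abs_mult using E[OF that, of z] lin[OF that, of z]
        by (intro mult_mono) auto
    qed
  qed measurable
  show ?B
  proof (rule has_real_derivative_integral[OF s, where D = "\<lambda>z. \<bar>k z\<bar> * ((l z)\<^sup>2 + (norm v)\<^sup>2) * e z"])
    show "integrable std_gauss (\<lambda>z. k z * (z \<bullet> v - t * (norm v)\<^sup>2) * E t z)" if "t \<in> {-R<..<R}" for t
      by (intro exp_bounded_integrable_std_gauss exp_bounded_intros k Eb that) measurable
    show "integrable std_gauss (\<lambda>z. \<bar>k z\<bar> * ((l z)\<^sup>2 + (norm v)\<^sup>2) * e z)"
      by (intro exp_bounded_integrable_std_gauss exp_bounded_intros k l e) measurable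
    show "((\<lambda>s. k z * (z \<bullet> v - s * (norm v)\<^sup>2) * E s z) has_real_derivative
        k z * ((z \<bullet> v - t * (norm v)\<^sup>2)\<^sup>2 - (norm v)\<^sup>2) * E t z) (at t)" for t z
      by (rule derivative_eq_intros D0 refl)+ (simp add: algebra_simps power2_eq_square)
    show "\<bar>k z * ((z \<bullet> v - t * (norm v)\<^sup>2)\<^sup>2 - (norm v)\<^sup>2) * E t z\<bar> \<le>
        \<bar>k z\<bar> * ((l z)\<^sup>2 + (norm v)\<^sup>2) * e z" if "t \<in> {-R<..<R}" for t z
    proof -
      have "(z \<bullet> v - t * (norm v)\<^sup>2)\<^sup>2 \<le> (l z)\<^sup>2"
        using power_mono[OF lin[OF that, of z], of 2] by simp
      then have "\<bar>(z \<bullet> v - t * (norm v)\<^sup>2)\<^sup>2 - (norm v)\<^sup>2\<bar> \<le> (l z)\<^sup>2 + (norm v)\<^sup>2"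
        using zero_le_power2[of "z \<bullet> v - t * (norm v)\<^sup>2"] zero_le_power2[of "norm v"] by linarith
      then show ?thesis
        unfolding abs_mult using E[OF that, of z] by (intro mult_mono) auto
    qed
  qed measurable
qed

text \<open>Cameron-Martin with \<open>w = s *\<^sub>R v\<close>: shifting \<open>z\<close> by
  \<open>s *\<^sub>R v\<close> cancels the recentring term in the quadratic weight. The first form
  gives the values in the Taylor formula, the second its remainder.\<close>

lemma std_gauss_tilt_eq_shift:
  fixes k :: "'a::euclidean_space \<Rightarrow> real" and v :: 'a
  assumes [measurable]: "k \<in> borel_measurable borel"
  shows "(\<integral>z. k z * exp (s * (z \<bullet> v) - s\<^sup>2 * (norm v)\<^sup>2 / 2) \<partial>std_gauss) =
      (\<integral>z. k (s *\<^sub>R v + z) \<partial>std_gauss)"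
    and "(\<integral>z. k z * ((z \<bullet> v - s * (norm v)\<^sup>2)\<^sup>2 - (norm v)\<^sup>2) *
        exp (s * (z \<bullet> v) - s\<^sup>2 * (norm v)\<^sup>2 / 2) \<partial>std_gauss) =
      (\<integral>z. k (s *\<^sub>R v + z) * ((z \<bullet> v)\<^sup>2 - (norm v)\<^sup>2) \<partial>std_gauss)"
  using std_gauss_cameron_martin[of k "s *\<^sub>R v"]
    std_gauss_cameron_martin[of "\<lambda>z. k z * ((z \<bullet> v - s * (norm v)\<^sup>2)\<^sup>2 - (norm v)\<^sup>2)" "s *\<^sub>R v"]
  by (simp_all add: power_mult_distrib inner_add_left power2_norm_eq_inner)

text \<open>Obtained by differentiating the constant total mass of the tilted Gaussian twice.\<close>

lemma std_gauss_inner_moments: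
  fixes v :: "'a::euclidean_space"
  shows "(\<integral>z. z \<bullet> v \<partial>std_gauss) = 0" and "(\<integral>z. (z \<bullet> v)\<^sup>2 \<partial>std_gauss) = (norm v)\<^sup>2"
proof -
  define E where "E s z = exp (s * (z \<bullet> v) - s\<^sup>2 * (norm v)\<^sup>2 / 2)" for s and z :: 'a
  note D = std_gauss_tilt_derivatives[where k = "\<lambda>_. 1" and v = v, OF exp_bounded_const
      borel_measurable_const, unfolded mult_1, folded E_def]
  have "(\<lambda>s. \<integral>z. E s z \<partial>std_gauss) = (\<lambda>_. 1)"
    using std_gauss_tilt_eq_shift(1)[where k = "\<lambda>_. 1" and v = v]
    by (simp add: E_def std_gauss.prob_space[simplified])
  then have first: "(\<integral>z. (z \<bullet> v - s * (norm v)\<^sup>2) * E s z \<partial>std_gauss) = 0" for s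
    using D(1)[of s] by (auto intro: DERIV_unique[OF _ DERIV_const])
  from first[of 0] show "(\<integral>z. z \<bullet> v \<partial>std_gauss) = 0" by (simp add: E_def)
  from first have "(\<integral>z. ((z \<bullet> v)\<^sup>2 - (norm v)\<^sup>2) \<partial>std_gauss) = 0"
    using D(2)[of 0] by (auto simp: E_def intro: DERIV_unique[OF _ DERIV_const])
  moreover have "integrable std_gauss (\<lambda>z. (z \<bullet> v)\<^sup>2)"
    by (intro exp_bounded_integrable_std_gauss exp_bounded_intros) measurable
  ultimately show "(\<integral>z. (z \<bullet> v)\<^sup>2 \<partial>std_gauss) = (norm v)\<^sup>2"
    by (simp add: std_gauss.prob_space[simplified])
qed

text \<open>Maclaurin's formula of order two for the map s to E k(s v + Z), differentiated in its
  tilted form and translated back into shifted form at the end points and at the intermediate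
  point.\<close>

lemma std_gauss_taylor:
  fixes k :: "'a::euclidean_space \<Rightarrow> real" and v :: 'a
  assumes k: "exp_bounded k" and [measurable]: "k \<in> borel_measurable borel"
  obtains t where "0 < t" "t < 1"
    "(\<integral>z. k (v + z) \<partial>std_gauss) = (\<integral>z. k z \<partial>std_gauss) + (\<integral>z. k z * (z \<bullet> v) \<partial>std_gauss) +
      (\<integral>z. k (t *\<^sub>R v + z) * ((z \<bullet> v)\<^sup>2 - (norm v)\<^sup>2) \<partial>std_gauss) / 2"
proof -
  define E where "E s z = exp (s * (z \<bullet> v) - s\<^sup>2 * (norm v)\<^sup>2 / 2)" for s and z :: 'a
  define G where "G m s = (if m = (0::nat) then \<integral>z. k z * E s z \<partial>std_gauss
    else if m = 1 then \<integral>z. k z * (z \<bullet> v - s * (norm v)\<^sup>2) * E s z \<partial>std_gauss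
    else \<integral>z. k z * ((z \<bullet> v - s * (norm v)\<^sup>2)\<^sup>2 - (norm v)\<^sup>2) * E s z \<partial>std_gauss)" for m s
  have "\<exists>t. 0 < t \<and> t < 1 \<and> G 0 1 = (\<Sum>m<2. G m 0 / fact m * 1 ^ m) + G 2 t / fact 2 * 1 ^ 2"
  proof (rule Maclaurin)
    show "\<forall>m t. m < 2 \<and> 0 \<le> t \<and> t \<le> 1 \<longrightarrow> (G m has_real_derivative G (Suc m) t) (at t)"
      using std_gauss_tilt_derivatives[OF k assms(2)]
      by (auto simp: G_def[abs_def] E_def less_2_cases_iff)
  qed auto
  then obtain t where t: "0 < t" "t < 1" "G 0 1 = G 0 0 + G 1 0 + G 2 t / 2"
    by (auto simp: numeral_2_eq_2)
  show thesis
    by (rule that[OF t(1,2)])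
       (use t(3) std_gauss_tilt_eq_shift[OF assms(2), where s = 1 and v = v] std_gauss_tilt_eq_shift(2)[OF assms(2), where s = t and v = v]
        in \<open>simp add: G_def E_def\<close>)
qed

subsection \<open>Isotropic laws\<close>

lemma lipschitz_borel_measurable:
  "L-lipschitz_on UNIV h \<Longrightarrow> (h :: 'a::real_normed_vector \<Rightarrow> real) \<in> borel_measurable borel"
  by (intro borel_measurable_continuous_onI lipschitz_on_continuous_on)

lemma le_one_plus_cube: "t \<le> 1 + t ^ 3" "t\<^sup>2 \<le> 1 + t ^ 3" if "0 \<le> t" for t :: real
proof -
  have "t \<le> 1 + t ^ 3 \<and> t\<^sup>2 \<le> 1 + t ^ 3"
  proof (cases "t \<le> 1")
    case True
    with that have "t\<^sup>2 \<le> 1" "0 \<le> t ^ 3" by (simp_all add: power_le_one)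
    with True show ?thesis by linarith
  next
    case False
    then have "t ^ 1 \<le> t ^ 3" "t\<^sup>2 \<le> t ^ 3" by (intro power_increasing; simp)+
    then show ?thesis by simp
  qed
  then show "t \<le> 1 + t ^ 3" "t\<^sup>2 \<le> 1 + t ^ 3" by auto
qed

text \<open>Both the law of the summands and the standard Gaussian are instances. Expansions are
  proved once and then subtracted from each other.\<close>

locale isotropic_law = prob_space \<nu> for \<nu> :: "'a::euclidean_space measure" +
  assumes sets_eq_borel [simp, measurable_cong]: "sets \<nu> = sets borel"
    and mean_zero: "b \<in> Basis \<Longrightarrow> (\<integral>y. y \<bullet> b \<partial>\<nu>) = 0"
    and covariance: "b \<in> Basis \<Longrightarrow> c \<in> Basis \<Longrightarrow> (\<integral>y. (y \<bullet> b) * (y \<bullet> c) \<partial>\<nu>) = of_bool (b = c)"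
    and third_moment: "integrable \<nu> (\<lambda>y. norm y ^ 3)"
begin

lemma integrable_one_plus_cube_growth:
  assumes [measurable]: "f \<in> borel_measurable borel" and f: "\<And>y. \<bar>f y\<bar> \<le> K * (1 + norm y ^ 3)"
  shows "integrable \<nu> (f :: 'a \<Rightarrow> real)"
proof (rule Bochner_Integration.integrable_bound)
  show "integrable \<nu> (\<lambda>y. K * (1 + norm y ^ 3))"
    using third_moment by simp
  show "AE y in \<nu>. norm (f y) \<le> norm (K * (1 + norm y ^ 3))"
    using f by (intro AE_I2) (metis abs_ge_self order_trans real_norm_def)
qed simp

lemma integrable_norm: "integrable \<nu> norm"
  by (rule integrable_one_plus_cube_growth[where K = 1]) (auto simp: le_one_plus_cube)

lemma integrable_norm_square: "integrable \<nu> (\<lambda>y. (norm y)\<^sup>2)"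
  by (rule integrable_one_plus_cube_growth[where K = 1]) (auto simp: le_one_plus_cube)

lemma integrable_inner: "integrable \<nu> (\<lambda>y. y \<bullet> b)"
  by (rule Bochner_Integration.integrable_bound[OF integrable_mult_left[OF integrable_norm, of "norm b"]])
     (auto simp: Cauchy_Schwarz_ineq2)

lemma integrable_inner_inner: "integrable \<nu> (\<lambda>y. (y \<bullet> b) * (y \<bullet> c))"
proof (rule Bochner_Integration.integrable_bound[OF integrable_mult_left[OF integrable_norm_square, of "norm b * norm c"]])
  have "\<bar>y \<bullet> b\<bar> * \<bar>y \<bullet> c\<bar> \<le> (norm y * norm b) * (norm y * norm c)" for y
    by (intro mult_mono Cauchy_Schwarz_ineq2) auto
  then show "AE y in \<nu>. norm ((y \<bullet> b) * (y \<bullet> c)) \<le> norm ((norm y)\<^sup>2 * (norm b * norm c))"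
    by (simp add: abs_mult power2_eq_square mult_ac)
qed simp

lemma integral_norm_square: "(\<integral>y. (norm y)\<^sup>2 \<partial>\<nu>) = DIM('a)"
proof -
  have "(norm y)\<^sup>2 = (\<Sum>b\<in>Basis. (y \<bullet> b) * (y \<bullet> b))" for y :: 'a
    unfolding power2_norm_eq_inner by (rule euclidean_inner)
  then show ?thesis
    by (simp add: integrable_inner_inner covariance)
qed

text \<open>Jensen's inequality for the square root, carried out through the tangent line at d: |y|
  \<le> |y|^2 / (2 r) + r / 2 with r = sqrt d.\<close>

lemma integral_norm_le: "(\<integral>y. norm y \<partial>\<nu>) \<le> sqrt DIM('a)"
proof -
  define r where "r = sqrt DIM('a)"
  have r: "0 < r" "r\<^sup>2 = DIM('a)" by (simp_all add: r_def)
  have "norm y \<le> (norm y)\<^sup>2 / (2 * r) + r / 2" for y :: 'a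
    using zero_le_power2[of "norm y - r"] r(1) by (simp add: field_simps power2_eq_square)
  then have "(\<integral>y. norm y \<partial>\<nu>) \<le> (\<integral>y. (norm y)\<^sup>2 / (2 * r) + r / 2 \<partial>\<nu>)"
    by (intro integral_mono integrable_norm Bochner_Integration.integrable_add
        Bochner_Integration.integrable_divide integrable_norm_square) auto
  also have "\<dots> = r\<^sup>2 / (2 * r) + r / 2"
    by (simp add: integrable_norm_square integral_norm_square prob_space r(2))
  also have "\<dots> = r" using r(1) by (simp add: power2_eq_square)
  finally show ?thesis by (simp add: r_def)
qed

text \<open>Jensen's inequality for t^(3/2) with t = |y|^2, again through the tangent line at t = d.
  It lets every dimensional factor be absorbed into the third moment.\<close>

lemma third_moment_ge: "real DIM('a) * sqrt DIM('a) \<le> (\<integral>y. norm y ^ 3 \<partial>\<nu>)"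
proof -
  define r where "r = sqrt DIM('a)"
  have r: "0 < r" "r\<^sup>2 = DIM('a)" by (simp_all add: r_def)
  have "3 / 2 * r * (norm y)\<^sup>2 - r ^ 3 / 2 \<le> norm y ^ 3" for y :: 'a
  proof -
    \<comment> \<open>This product expands to the difference between |y|^3 and its tangent, which
      has a double root at |y| = r.\<close>
    have "0 \<le> (norm y - r)\<^sup>2 * (norm y + r / 2)" using r(1) by simp
    then show ?thesis by (simp add: power2_eq_square power3_eq_cube algebra_simps)
  qed
  then have "(\<integral>y. 3 / 2 * r * (norm y)\<^sup>2 - r ^ 3 / 2 \<partial>\<nu>) \<le> (\<integral>y. norm y ^ 3 \<partial>\<nu>)"
    by (intro integral_mono third_moment Bochner_Integration.integrable_diff
        integrable_mult_right integrable_norm_square) auto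
  also have "(\<integral>y. 3 / 2 * r * (norm y)\<^sup>2 - r ^ 3 / 2 \<partial>\<nu>) = 3 / 2 * r * r\<^sup>2 - r ^ 3 / 2"
    by (simp add: integrable_norm_square integral_norm_square prob_space r(2))
  also have "\<dots> = r\<^sup>2 * r" by (simp add: power2_eq_square power3_eq_cube)
  finally show ?thesis by (simp add: r) (simp add: r_def)
qed

end

lemma std_gauss_isotropic: "isotropic_law (std_gauss :: 'a::euclidean_space measure)"
proof
  fix b c :: 'a
  assume b: "b \<in> Basis" and c: "c \<in> Basis"
  have int: "integrable std_gauss (\<lambda>z. (z \<bullet> w)\<^sup>2)" for w :: 'a
    by (intro exp_bounded_integrable_std_gauss exp_bounded_intros) measurable
  \<comment> \<open>Polarisation reduces the covariance to second moments in a single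
    direction.\<close>
  have "(z \<bullet> b) * (z \<bullet> c) = ((z \<bullet> (b + c))\<^sup>2 - (z \<bullet> b)\<^sup>2 - (z \<bullet> c)\<^sup>2) / 2" for z
    by (simp add: inner_add_right power2_eq_square algebra_simps)
  then have "(\<integral>z. (z \<bullet> b) * (z \<bullet> c) \<partial>std_gauss) = ((norm (b + c))\<^sup>2 - (norm b)\<^sup>2 - (norm c)\<^sup>2) / 2"
    by (simp only:) (simp add: int std_gauss_inner_moments)
  also have "\<dots> = b \<bullet> c"
    by (simp add: power2_norm_eq_inner inner_add_left inner_add_right inner_commute)
  finally show "(\<integral>z. (z \<bullet> b) * (z \<bullet> c) \<partial>std_gauss) = of_bool (b = c)"
    using b c by (simp add: inner_Basis)
next
  show "integrable std_gauss (\<lambda>z::'a. norm z ^ 3)"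
    by (intro exp_bounded_integrable_std_gauss exp_bounded_intros) measurable
qed (simp_all add: std_gauss_inner_moments)

interpretation std_gauss: isotropic_law std_gauss
  by (rule std_gauss_isotropic)

text \<open>Cauchy-Schwarz over the coordinates gives E|Z|^4 \<le> 3 d^2, and |z|^3 \<le> r |z|^2 /
  2 + |z|^4 / (2 r) with r = sqrt d interpolates: d r / 2 + 3 d r / 2 = 2 d r. Together with
  \<open>third_moment_ge\<close>, the third moment of the Gaussian is at most twice that of any
  isotropic law.\<close>

lemma std_gauss_third_moment_le:
  "(\<integral>z. norm z ^ 3 \<partial>(std_gauss :: 'a::euclidean_space measure)) \<le> 2 * (real DIM('a) * sqrt DIM('a))"
proof -
  define d where "d = real DIM('a)"
  define r where "r = sqrt d"
  have r: "0 < r" "r\<^sup>2 = d" by (simp_all add: r_def d_def)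
  have int4: "integrable std_gauss (\<lambda>z. (z \<bullet> b) ^ 4)" for b :: 'a
    by (intro exp_bounded_integrable_std_gauss exp_bounded_intros) measurable
  have fourth: "norm z ^ 4 \<le> d * (\<Sum>b\<in>Basis. (z \<bullet> b) ^ 4)" for z :: 'a
  proof -
    have "norm z ^ 4 = (\<Sum>b\<in>Basis. (z \<bullet> b)\<^sup>2)\<^sup>2"
      using power2_norm_eq_inner[of z] euclidean_inner[of z z]
      by (simp add: power2_eq_square numeral_eq_Suc)
    also have "\<dots> \<le> (\<Sum>b\<in>(Basis::'a set). 1\<^sup>2) * (\<Sum>b\<in>Basis. ((z \<bullet> b)\<^sup>2)\<^sup>2)"
      using Cauchy_Schwarz_ineq_sum[of "\<lambda>_. 1" "\<lambda>b. (z \<bullet> b)\<^sup>2" Basis] by simp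
    finally show ?thesis by (simp add: d_def flip: power_mult)
  qed
  have "norm z ^ 3 \<le> r / 2 * (norm z)\<^sup>2 + d * (\<Sum>b\<in>Basis. (z \<bullet> b) ^ 4) / (2 * r)" for z :: 'a
  proof -
    have "0 \<le> (norm z * (norm z - r))\<^sup>2" by simp
    then have "2 * r * norm z ^ 3 \<le> r\<^sup>2 * (norm z)\<^sup>2 + norm z ^ 4"
      by (simp add: power2_eq_square numeral_eq_Suc algebra_simps)
    with fourth[of z] have "2 * r * norm z ^ 3 \<le> r\<^sup>2 * (norm z)\<^sup>2 + d * (\<Sum>b\<in>Basis. (z \<bullet> b) ^ 4)"
      by linarith
    with r(1) show ?thesis by (simp add: field_simps power2_eq_square)
  qed
  then have "(\<integral>z. norm z ^ 3 \<partial>(std_gauss :: 'a measure)) \<le>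
      (\<integral>z. r / 2 * (norm z)\<^sup>2 + d * (\<Sum>b\<in>Basis. (z \<bullet> b) ^ 4) / (2 * r) \<partial>(std_gauss :: 'a measure))"
    by (intro integral_mono std_gauss.third_moment Bochner_Integration.integrable_add
        integrable_mult_right std_gauss.integrable_norm_square Bochner_Integration.integrable_divide
        Bochner_Integration.integrable_sum int4)
  also have "\<dots> = r / 2 * d + d * (\<Sum>b\<in>(Basis::'a set). 3) / (2 * r)"
  proof -
    have "(\<integral>z. (z \<bullet> b) ^ 4 \<partial>std_gauss) = 3" if "b \<in> Basis" for b :: 'a
      using has_bochner_integral_integral_eq[OF std_gauss_moment_coordinate[OF that, of 2]]
      by (simp add: fact_numeral)
    then show ?thesis
      by (simp add: std_gauss.integrable_norm_square int4 std_gauss.integral_norm_square d_def)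
  qed
  also have "\<dots> = 2 * (d * r)"
    using r(1) by (simp add: d_def[symmetric] flip: r(2)) (simp add: numeral_eq_Suc field_simps)
  finally show ?thesis by (simp add: d_def r_def)
qed

subsection \<open>Gaussian smoothing of Lipschitz functions\<close>

text \<open>The heat semigroup, parametrised by standard deviation instead of time. The value
  \<sigma> = 0 is included and returns \<open>h\<close>, which is the situation in the last
  replacement.\<close>

definition gauss_smooth :: "real \<Rightarrow> ('a::euclidean_space \<Rightarrow> real) \<Rightarrow> 'a \<Rightarrow> real" where
  "gauss_smooth \<sigma> h x = (\<integral>z. h (x + \<sigma> *\<^sub>R z) \<partial>std_gauss)"

context
  fixes h :: "'a::euclidean_space \<Rightarrow> real"
  assumes h: "1-lipschitz_on UNIV h"
begin

lemma lipschitz_one_measurable [measurable]: "h \<in> borel_measurable borel"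
  using h by (rule lipschitz_borel_measurable)

lemma lipschitz_one_diff_le: "\<bar>h x - h y\<bar> \<le> norm (x - y)"
  using lipschitz_on_normD[OF h, of x y] by simp

lemma gauss_smooth_zero: "gauss_smooth 0 h = h"
  by (simp add: gauss_smooth_def fun_eq_iff std_gauss.prob_space[simplified])

lemma gauss_smooth_lipschitz: "1-lipschitz_on UNIV (gauss_smooth \<sigma> h)"
proof (rule lipschitz_onI)
  fix x y :: 'a
  have int: "integrable std_gauss (\<lambda>z. h (x + \<sigma> *\<^sub>R z))" for x
    by (intro exp_bounded_integrable_std_gauss exp_bounded_lipschitz[OF h]) measurable
  have diff: "\<bar>h (x + \<sigma> *\<^sub>R z) - h (y + \<sigma> *\<^sub>R z)\<bar> \<le> norm (x - y)" for z
    using lipschitz_one_diff_le[of "x + \<sigma> *\<^sub>R z" "y + \<sigma> *\<^sub>R z"] by simp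
  have "\<bar>gauss_smooth \<sigma> h x - gauss_smooth \<sigma> h y\<bar> = \<bar>\<integral>z. h (x + \<sigma> *\<^sub>R z) - h (y + \<sigma> *\<^sub>R z) \<partial>std_gauss\<bar>"
    by (simp add: gauss_smooth_def int)
  also have "\<dots> \<le> (\<integral>z. norm (x - y) \<partial>(std_gauss :: 'a measure))"
    using diff by (intro order_trans[OF integral_abs_bound] integral_mono integrable_abs
        Bochner_Integration.integrable_diff int) simp_all
  finally show "dist (gauss_smooth \<sigma> h x) (gauss_smooth \<sigma> h y) \<le> 1 * dist x y"
    by (simp add: dist_norm std_gauss.prob_space[simplified])
qed simp

text \<open>The remainder of \<open>std_gauss_taylor\<close> carries the second derivative at an
  intermediate point. Moving it to \<open>x\<close> costs at most \<sigma> |v| by the Lipschitz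
  property, times the mean of the weight <z,v>^2 + |v|^2, which is 2 |v|^2; the factor 1/2 of the
  Taylor formula leaves constant 1.\<close>

lemma gauss_smooth_taylor:
  assumes \<sigma>: "0 < \<sigma>"
  shows "\<bar>gauss_smooth \<sigma> h (x + \<sigma> *\<^sub>R v) - gauss_smooth \<sigma> h x
      - (\<integral>z. h (x + \<sigma> *\<^sub>R z) * (z \<bullet> v) \<partial>std_gauss)
      - (\<integral>z. h (x + \<sigma> *\<^sub>R z) * ((z \<bullet> v)\<^sup>2 - (norm v)\<^sup>2) \<partial>std_gauss) / 2\<bar> \<le> \<sigma> * norm v ^ 3"
proof -
  define k where "k z = h (x + \<sigma> *\<^sub>R z)" for z
  have k [measurable]: "k \<in> borel_measurable borel" unfolding k_def by measurable
  have kb: "exp_bounded k" unfolding k_def by (rule exp_bounded_lipschitz[OF h])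
  obtain t where t: "0 < t" "t < 1"
    "(\<integral>z. k (v + z) \<partial>std_gauss) = (\<integral>z. k z \<partial>std_gauss) + (\<integral>z. k z * (z \<bullet> v) \<partial>std_gauss) +
      (\<integral>z. k (t *\<^sub>R v + z) * ((z \<bullet> v)\<^sup>2 - (norm v)\<^sup>2) \<partial>std_gauss) / 2"
    by (rule std_gauss_taylor[OF kb k])
  have kbt: "exp_bounded (\<lambda>z. k (t *\<^sub>R v + z))"
    using exp_bounded_lipschitz[OF h, of "x + \<sigma> *\<^sub>R t *\<^sub>R v" \<sigma>]
    by (simp add: k_def scaleR_add_right add.assoc)
  have int: "integrable std_gauss (\<lambda>z. k z * ((z \<bullet> v)\<^sup>2 - (norm v)\<^sup>2))"
    "integrable std_gauss (\<lambda>z. k (t *\<^sub>R v + z) * ((z \<bullet> v)\<^sup>2 - (norm v)\<^sup>2))"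
    "integrable std_gauss (\<lambda>z. (z \<bullet> v)\<^sup>2)"
    by (intro exp_bounded_integrable_std_gauss exp_bounded_intros kb kbt; measurable)+
  have "\<bar>(k (t *\<^sub>R v + z) - k z) * ((z \<bullet> v)\<^sup>2 - (norm v)\<^sup>2)\<bar> \<le> \<sigma> * norm v * ((z \<bullet> v)\<^sup>2 + (norm v)\<^sup>2)" for z
  proof -
    have "\<bar>k (t *\<^sub>R v + z) - k z\<bar> \<le> norm ((\<sigma> * t) *\<^sub>R v)"
      using lipschitz_one_diff_le[of "x + \<sigma> *\<^sub>R (t *\<^sub>R v + z)" "x + \<sigma> *\<^sub>R z"] by (simp add: k_def scaleR_add_right)
    also have "\<dots> \<le> \<sigma> * norm v"
      using \<sigma> t by (simp add: abs_mult mult.assoc mult_left_le_one_le)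
    finally show ?thesis unfolding abs_mult
      by (intro mult_mono) (auto simp: abs_le_iff \<sigma> less_imp_le)
  qed
  then have "\<bar>\<integral>z. (k (t *\<^sub>R v + z) - k z) * ((z \<bullet> v)\<^sup>2 - (norm v)\<^sup>2) \<partial>std_gauss\<bar> \<le>
      (\<integral>z. \<sigma> * norm v * ((z \<bullet> v)\<^sup>2 + (norm v)\<^sup>2) \<partial>std_gauss)"
    using int by (intro order_trans[OF integral_abs_bound] integral_mono) (auto simp: left_diff_distrib)
  also have "\<dots> = 2 * (\<sigma> * norm v ^ 3)"
    by (simp add: int std_gauss_inner_moments std_gauss.prob_space[simplified])
      (simp add: power2_eq_square power3_eq_cube)
  also have "(\<integral>z. (k (t *\<^sub>R v + z) - k z) * ((z \<bullet> v)\<^sup>2 - (norm v)\<^sup>2) \<partial>std_gauss) =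
      (\<integral>z. k (t *\<^sub>R v + z) * ((z \<bullet> v)\<^sup>2 - (norm v)\<^sup>2) \<partial>std_gauss) -
      (\<integral>z. k z * ((z \<bullet> v)\<^sup>2 - (norm v)\<^sup>2) \<partial>std_gauss)"
    unfolding left_diff_distrib[of "k _"] using int by simp
  finally have "\<bar>(\<integral>z. k (v + z) \<partial>std_gauss) - (\<integral>z. k z \<partial>std_gauss) - (\<integral>z. k z * (z \<bullet> v) \<partial>std_gauss)
      - (\<integral>z. k z * ((z \<bullet> v)\<^sup>2 - (norm v)\<^sup>2) \<partial>std_gauss) / 2\<bar> \<le> \<sigma> * norm v ^ 3"
    using t(3) by linarith
  then show ?thesis
    by (simp add: k_def gauss_smooth_def scaleR_add_right add.assoc)
qed

end

text \<open>Separates the direction \<open>v\<close> from the integration over \<open>z\<close>, so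
  that the Taylor terms become polynomials in \<open>v\<close> which can be integrated against
  another law.\<close>

lemma integral_mult_inner_eq_sum:
  fixes f :: "'a::euclidean_space \<Rightarrow> real" and v :: 'a
  assumes "\<And>b. b \<in> Basis \<Longrightarrow> integrable M (\<lambda>z. f z * (z \<bullet> b))"
  shows "(\<integral>z. f z * (z \<bullet> v) \<partial>M) = (\<Sum>b\<in>Basis. (v \<bullet> b) * (\<integral>z. f z * (z \<bullet> b) \<partial>M))"
proof -
  have "f z * (z \<bullet> v) = (\<Sum>b\<in>Basis. (v \<bullet> b) * (f z * (z \<bullet> b)))" for z
    by (subst euclidean_inner[of z v]) (simp add: sum_distrib_left mult_ac)
  then show ?thesis using assms by simp
qed

section \<open>Expansion and exchange estimates under an isotropic law\<close>

context isotropic_law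
begin

lemma lipschitz_integrable:
  assumes g: "1-lipschitz_on UNIV g"
  shows "integrable \<nu> (\<lambda>y. g (x + t *\<^sub>R y) :: real)"
proof (rule Bochner_Integration.integrable_bound)
  show "integrable \<nu> (\<lambda>y. \<bar>g x\<bar> + \<bar>t\<bar> * norm y)"
    using integrable_norm by simp
  have [measurable]: "g \<in> borel_measurable borel" using g by (rule lipschitz_borel_measurable)
  show "(\<lambda>y. g (x + t *\<^sub>R y)) \<in> borel_measurable \<nu>" by measurable
  have "\<bar>g (x + t *\<^sub>R y)\<bar> \<le> \<bar>g x\<bar> + \<bar>t\<bar> * norm y" for y
    using lipschitz_on_normD[OF g, of "x + t *\<^sub>R y" x] by simp
  then show "AE y in \<nu>. norm (g (x + t *\<^sub>R y)) \<le> norm (\<bar>g x\<bar> + \<bar>t\<bar> * norm y)"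
    by (intro AE_I2) (simp add: abs_of_nonneg)
qed

text \<open>Integrating the Taylor polynomial over \<nu> involves only first and second moments: the
  linear term vanishes, and the quadratic one keeps just its diagonal. The main term is therefore
  the same for all isotropic laws.\<close>

lemma gauss_smooth_expansion:
  assumes h: "1-lipschitz_on UNIV h" and \<sigma>: "0 < \<sigma>" and \<tau>: "0 < \<tau>"
  shows "\<bar>(\<integral>y. gauss_smooth \<sigma> h (x + \<tau> *\<^sub>R y) \<partial>\<nu>) - gauss_smooth \<sigma> h x - (\<tau> / \<sigma>)\<^sup>2 / 2 *
      ((\<Sum>b\<in>Basis. \<integral>z. h (x + \<sigma> *\<^sub>R z) * (z \<bullet> b)\<^sup>2 \<partial>std_gauss) - DIM('a) * gauss_smooth \<sigma> h x)\<bar>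
    \<le> \<tau> ^ 3 / \<sigma>\<^sup>2 * (\<integral>y. norm y ^ 3 \<partial>\<nu>)"
proof -
  \<comment> \<open>The increment \<tau> y is written as \<sigma> (r y) to match
    \<open>gauss_smooth_taylor\<close> with v = r y; its error \<sigma> |r y|^3 is then (\<tau>^3 /
    \<sigma>^2) |y|^3.\<close>
  define r where "r = \<tau> / \<sigma>"
  define k where "k z = h (x + \<sigma> *\<^sub>R z)" for z
  have [measurable]: "h \<in> borel_measurable borel" using h by (rule lipschitz_borel_measurable)
  have [measurable]: "k \<in> borel_measurable borel" unfolding k_def by measurable
  have kb: "exp_bounded k" unfolding k_def by (rule exp_bounded_lipschitz[OF h])
  define k0 where "k0 = gauss_smooth \<sigma> h x"
  have k0: "k0 = (\<integral>z. k z \<partial>std_gauss)" by (simp add: k0_def gauss_smooth_def k_def)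
  define m where "m b = (\<integral>z. k z * (z \<bullet> b) \<partial>std_gauss)" for b :: 'a
  define K where "K b c = (\<integral>z. k z * (z \<bullet> b) * (z \<bullet> c) \<partial>std_gauss)" for b c :: 'a
  have int: "integrable std_gauss k" "integrable std_gauss (\<lambda>z. k z * (z \<bullet> b))"
    "integrable std_gauss (\<lambda>z. k z * (z \<bullet> b) * (z \<bullet> c))" for b c :: 'a
    by (intro exp_bounded_integrable_std_gauss exp_bounded_intros kb; measurable)+
  have lin: "(\<integral>z. k z * (z \<bullet> v) \<partial>std_gauss) = (\<Sum>b\<in>Basis. (v \<bullet> b) * m b)" for v
    unfolding m_def by (rule integral_mult_inner_eq_sum) (rule int)
  have quad: "(\<integral>z. k z * ((z \<bullet> v)\<^sup>2 - (norm v)\<^sup>2) \<partial>std_gauss) =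
      (\<Sum>b\<in>Basis. \<Sum>c\<in>Basis. ((v \<bullet> b) * (v \<bullet> c)) * K b c) - (norm v)\<^sup>2 * k0" for v
  proof -
    have swap: "(\<lambda>z. k z * (z \<bullet> v) * (z \<bullet> b)) = (\<lambda>z. (k z * (z \<bullet> b)) * (z \<bullet> v))" for b
      by (simp add: mult_ac)
    have "(\<integral>z. k z * (z \<bullet> v) * (z \<bullet> b) \<partial>std_gauss) = (\<Sum>c\<in>Basis. (v \<bullet> c) * K b c)" for b
      unfolding swap K_def by (rule integral_mult_inner_eq_sum) (rule int)
    moreover have "(\<integral>z. (k z * (z \<bullet> v)) * (z \<bullet> v) \<partial>std_gauss) =
        (\<Sum>b\<in>Basis. (v \<bullet> b) * (\<integral>z. k z * (z \<bullet> v) * (z \<bullet> b) \<partial>std_gauss))"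
      by (rule integral_mult_inner_eq_sum) (rule int)
    ultimately have "(\<integral>z. k z * (z \<bullet> v) * (z \<bullet> v) \<partial>std_gauss) =
        (\<Sum>b\<in>Basis. \<Sum>c\<in>Basis. ((v \<bullet> b) * (v \<bullet> c)) * K b c)"
      by (simp add: sum_distrib_left mult.assoc)
    moreover have "k z * ((z \<bullet> v)\<^sup>2 - (norm v)\<^sup>2) = k z * (z \<bullet> v) * (z \<bullet> v) - (norm v)\<^sup>2 * k z" for z
      by (simp add: algebra_simps power2_eq_square)
    ultimately show ?thesis by (simp add: int k0)
  qed
  \<comment> \<open>The Taylor remainder at v = r y, with the powers of \<open>r\<close> moved into
    the coefficients so that each term is a constant times a moment of \<nu>.\<close>
  define R where "R y = gauss_smooth \<sigma> h (x + \<tau> *\<^sub>R y) - k0 - (\<Sum>b\<in>Basis. (y \<bullet> b) * (r * m b))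
      - ((\<Sum>b\<in>Basis. \<Sum>c\<in>Basis. ((y \<bullet> b) * (y \<bullet> c)) * (r\<^sup>2 * K b c)) - (norm y)\<^sup>2 * (r\<^sup>2 * k0)) / 2" for y
  have R: "\<bar>R y\<bar> \<le> \<tau> ^ 3 / \<sigma>\<^sup>2 * norm y ^ 3" for y
  proof -
    have "\<sigma> * r = \<tau>" "0 < r" using \<sigma> \<tau> by (simp_all add: r_def)
    moreover have "\<sigma> * norm (r *\<^sub>R y) ^ 3 = \<tau> ^ 3 / \<sigma>\<^sup>2 * norm y ^ 3"
      using \<sigma> \<tau> by (simp add: r_def power_mult_distrib power_divide power2_eq_square power3_eq_cube)
    ultimately show ?thesis
      using gauss_smooth_taylor[OF h \<sigma>, of x "r *\<^sub>R y", folded k_def k0_def, unfolded lin quad]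
      by (simp add: R_def power_mult_distrib power2_eq_square mult_ac)
  qed
  have "has_bochner_integral \<nu> R ((\<integral>y. gauss_smooth \<sigma> h (x + \<tau> *\<^sub>R y) \<partial>\<nu>) - k0
      - (\<Sum>b\<in>(Basis::'a set). 0 * (r * m b))
      - ((\<Sum>b\<in>(Basis::'a set). \<Sum>c\<in>Basis. of_bool (b = c) * (r\<^sup>2 * K b c)) - DIM('a) * (r\<^sup>2 * k0)) / 2)"
    unfolding R_def
    by (intro has_bochner_integral_diff has_bochner_integral_divide_zero has_bochner_integral_sum
        has_bochner_integral_mult_left)
       (simp_all add: has_bochner_integral_iff prob_space mean_zero covariance integral_norm_square
        integrable_norm_square integrable_inner integrable_inner_inner
        lipschitz_integrable gauss_smooth_lipschitz[OF h])
  moreover have "(\<Sum>b\<in>(Basis::'a set). \<Sum>c\<in>Basis. of_bool (b = c) * (r\<^sup>2 * K b c)) = r\<^sup>2 * (\<Sum>b\<in>Basis. K b b)"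
    by (simp add: of_bool_def mult_if_delta sum_distrib_left)
  ultimately have int_R: "integrable \<nu> R" and "(\<integral>y. R y \<partial>\<nu>) =
      (\<integral>y. gauss_smooth \<sigma> h (x + \<tau> *\<^sub>R y) \<partial>\<nu>) - k0 - r\<^sup>2 / 2 * ((\<Sum>b\<in>Basis. K b b) - DIM('a) * k0)"
    by (auto simp: has_bochner_integral_iff field_simps)
  moreover have "\<bar>\<integral>y. R y \<partial>\<nu>\<bar> \<le> (\<integral>y. \<tau> ^ 3 / \<sigma>\<^sup>2 * norm y ^ 3 \<partial>\<nu>)"
    by (intro order_trans[OF integral_abs_bound] integral_mono integrable_abs int_R
        integrable_mult_right third_moment R)
  ultimately show ?thesis
    by (simp add: r_def k0_def K_def k_def power2_eq_square mult.assoc)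
qed

text \<open>The main terms of the two expansions cancel. The factor 3 is 1 for \<nu> plus 2 for the
  Gaussian, whose third moment is at most twice that of \<nu>.\<close>

lemma gauss_smooth_exchange:
  assumes h: "1-lipschitz_on UNIV h" and \<sigma>: "0 < \<sigma>" and \<tau>: "0 < \<tau>"
  shows "\<bar>(\<integral>y. gauss_smooth \<sigma> h (x + \<tau> *\<^sub>R y) \<partial>\<nu>) - (\<integral>z. gauss_smooth \<sigma> h (x + \<tau> *\<^sub>R z) \<partial>std_gauss)\<bar>
    \<le> \<tau> ^ 3 / \<sigma>\<^sup>2 * (3 * (\<integral>y. norm y ^ 3 \<partial>\<nu>))"
proof -
  have "\<tau> ^ 3 / \<sigma>\<^sup>2 * (\<integral>z. norm z ^ 3 \<partial>(std_gauss :: 'a measure)) \<le> \<tau> ^ 3 / \<sigma>\<^sup>2 * (2 * (\<integral>y. norm y ^ 3 \<partial>\<nu>))"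
    using std_gauss_third_moment_le[where 'a = 'a] third_moment_ge \<tau> by (intro mult_left_mono) auto
  with gauss_smooth_expansion[OF assms, of x] std_gauss.gauss_smooth_expansion[OF assms, of x]
  show ?thesis by (simp add: abs_le_iff)
qed

text \<open>Without smoothing, both integrals are compared with \<open>h x\<close>. Each differs
  from it by at most \<tau> times a first moment, hence by \<tau> sqrt d, and sqrt d \<le> d sqrt d
  is below the third moment.\<close>

lemma lipschitz_exchange:
  assumes h: "1-lipschitz_on UNIV h" and \<tau>: "0 < \<tau>"
  shows "\<bar>(\<integral>y. h (x + \<tau> *\<^sub>R y) \<partial>\<nu>) - (\<integral>z. h (x + \<tau> *\<^sub>R z) \<partial>std_gauss)\<bar>
    \<le> \<tau> * (2 * (\<integral>y. norm y ^ 3 \<partial>\<nu>))"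
proof -
  have near: "\<bar>(\<integral>y. h (x + \<tau> *\<^sub>R y) \<partial>\<mu>) - h x\<bar> \<le> \<tau> * sqrt DIM('a)" if "isotropic_law \<mu>" for \<mu>
  proof -
    interpret \<mu>: isotropic_law \<mu> by fact
    have "\<bar>(\<integral>y. h (x + \<tau> *\<^sub>R y) \<partial>\<mu>) - h x\<bar> = \<bar>\<integral>y. h (x + \<tau> *\<^sub>R y) - h x \<partial>\<mu>\<bar>"
      by (simp add: \<mu>.lipschitz_integrable[OF h] \<mu>.prob_space)
    also have "\<dots> \<le> (\<integral>y. \<tau> * norm y \<partial>\<mu>)"
      using lipschitz_one_diff_le[OF h, of "x + \<tau> *\<^sub>R _" x] \<tau>
      by (intro order_trans[OF integral_abs_bound] integral_mono integrable_abs \<mu>.integrable_norm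
        integrable_mult_right Bochner_Integration.integrable_diff \<mu>.lipschitz_integrable[OF h]) simp_all
    also have "\<dots> \<le> \<tau> * sqrt DIM('a)"
      using \<mu>.integral_norm_le \<tau> by simp
    finally show ?thesis .
  qed
  have "1 * sqrt DIM('a) \<le> real DIM('a) * sqrt DIM('a)"
    by (intro mult_right_mono) (simp_all add: Suc_leI)
  with third_moment_ge have "sqrt DIM('a) \<le> (\<integral>y. norm y ^ 3 \<partial>\<nu>)" by linarith
  with \<tau> have "\<tau> * sqrt DIM('a) \<le> \<tau> * (\<integral>y. norm y ^ 3 \<partial>\<nu>)" by simp
  with near[OF isotropic_law_axioms] near[OF std_gauss_isotropic] show ?thesis by linarith
qed

end

text \<open>The sum of \<sigma> and \<tau> times two independent Gaussians has the law of \<rho>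
  times one. The case \<sigma> = 0 is covered, as the last replacement requires.\<close>

lemma gauss_smooth_semigroup:
  assumes h: "1-lipschitz_on UNIV h" and \<tau>: "0 < \<tau>" and \<rho>: "0 < \<rho>" "\<rho>\<^sup>2 = \<sigma>\<^sup>2 + \<tau>\<^sup>2"
  shows "(\<integral>z. gauss_smooth \<sigma> h (x + \<tau> *\<^sub>R z) \<partial>std_gauss) = gauss_smooth \<rho> h (x :: 'a::euclidean_space)"
proof -
  interpret P: pair_prob_space "std_gauss :: 'a measure" "std_gauss :: 'a measure" ..
  \<comment> \<open>The \<tau>-variable is put second because \<open>std_gauss_convolution\<close>
    asks for a positive second coefficient; it then becomes the outer variable through
    \<open>integral_snd\<close>.\<close>
  let ?f = "\<lambda>(z, w). (\<sigma> / \<rho>) *\<^sub>R z + (\<tau> / \<rho>) *\<^sub>R w"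
  have [measurable]: "h \<in> borel_measurable borel" using h by (rule lipschitz_borel_measurable)
  have D: "distr (std_gauss \<Otimes>\<^sub>M std_gauss) borel ?f = (std_gauss :: 'a measure)"
    using \<tau> \<rho> by (intro std_gauss_convolution) (simp_all add: power_divide flip: add_divide_distrib)
  have int: "integrable (std_gauss :: 'a measure) (\<lambda>u. h (x + \<rho> *\<^sub>R u))"
    by (rule std_gauss.lipschitz_integrable[OF h])
  have eq: "h (x + \<rho> *\<^sub>R ?f p) = (case p of (z, w) \<Rightarrow> h (x + \<tau> *\<^sub>R w + \<sigma> *\<^sub>R z))" for p
    using \<rho>(1) by (simp add: split_def scaleR_add_right add_ac)
  have "gauss_smooth \<rho> h x = (\<integral>u. h (x + \<rho> *\<^sub>R u) \<partial>distr (std_gauss \<Otimes>\<^sub>M std_gauss) borel ?f)"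
    by (simp add: D gauss_smooth_def)
  also have "\<dots> = (\<integral>p. (case p of (z, w) \<Rightarrow> h (x + \<tau> *\<^sub>R w + \<sigma> *\<^sub>R z)) \<partial>(std_gauss \<Otimes>\<^sub>M std_gauss))"
    unfolding eq[symmetric] by (rule integral_distr) measurable
  also have "\<dots> = (\<integral>w. \<integral>z. h (x + \<tau> *\<^sub>R w + \<sigma> *\<^sub>R z) \<partial>std_gauss \<partial>std_gauss)"
  proof (rule P.integral_snd[symmetric])
    have "integrable (distr (std_gauss \<Otimes>\<^sub>M std_gauss) borel ?f) (\<lambda>u. h (x + \<rho> *\<^sub>R u))"
      unfolding D by (rule int)
    then have "integrable (std_gauss \<Otimes>\<^sub>M std_gauss) (\<lambda>p. h (x + \<rho> *\<^sub>R ?f p))"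
      by (rule integrable_distr[rotated]) measurable
    then show "integrable (std_gauss \<Otimes>\<^sub>M std_gauss) (\<lambda>(z, w). h (x + \<tau> *\<^sub>R w + \<sigma> *\<^sub>R z))"
      unfolding eq by (simp add: split_def)
  qed
  finally show ?thesis by (simp add: gauss_smooth_def)
qed

subsection \<open>Lindeberg replacement\<close>

lemma (in prob_space) indep_vars_sum_euclidean:
  fixes X :: "'i \<Rightarrow> 'a \<Rightarrow> 'b::euclidean_space"
  assumes I: "finite I" "i \<notin> I" and indep: "indep_vars (\<lambda>_. borel) X (insert i I)"
  shows "indep_var borel (\<lambda>\<omega>. \<Sum>j\<in>I. X j \<omega>) borel (X i)"
proof -
  have "indep_var
    borel ((\<lambda>f. \<Sum>j\<in>I. f j) \<circ> (\<lambda>\<omega>. restrict (\<lambda>j. X j \<omega>) I))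
    borel ((\<lambda>f. f i) \<circ> (\<lambda>\<omega>. restrict (\<lambda>j. X j \<omega>) {i}))"
    using I by (intro indep_var_compose[OF indep_var_restrict[OF indep]]) auto
  also have "((\<lambda>f. f i) \<circ> (\<lambda>\<omega>. restrict (\<lambda>j. X j \<omega>) {i})) = X i"
    by auto
  also have "((\<lambda>f. \<Sum>j\<in>I. f j) \<circ> (\<lambda>\<omega>. restrict (\<lambda>j. X j \<omega>) I)) = (\<lambda>\<omega>. \<Sum>j\<in>I. X j \<omega>)"
    by (auto cong: rev_conj_cong)
  finally show ?thesis .
qed

text \<open>By independence and Fubini, \<open>Y\<close> is integrated first with \<open>S\<close>
  frozen at a point x. The bound there is uniform in x and survives integration over the law of
  \<open>S\<close>.\<close>

lemma (in prob_space) lindeberg_step: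
  fixes S Y :: "'a \<Rightarrow> 'b::euclidean_space" and g g' :: "'b \<Rightarrow> real"
  assumes indep: "indep_var borel S borel Y"
    and S: "integrable M S" and Y: "integrable M Y"
    and g: "1-lipschitz_on UNIV g" and g': "1-lipschitz_on UNIV g'"
    and bound: "\<And>x. \<bar>(\<integral>y. g (x + \<tau> *\<^sub>R y) \<partial>distr M borel Y) - g' x\<bar> \<le> \<delta>"
  shows "\<bar>expectation (\<lambda>\<omega>. g (S \<omega> + \<tau> *\<^sub>R Y \<omega>)) - expectation (\<lambda>\<omega>. g' (S \<omega>))\<bar> \<le> \<delta>"
proof -
  have [measurable]: "random_variable borel S" "random_variable borel Y"
    using indep by (auto dest: indep_var_rv1 indep_var_rv2)
  have [measurable]: "g \<in> borel_measurable borel" "g' \<in> borel_measurable borel"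
    using lipschitz_borel_measurable[OF g] lipschitz_borel_measurable[OF g'] by simp_all
  interpret Y: prob_space "distr M borel Y" by (rule prob_space_distr) measurable
  interpret S: prob_space "distr M borel S" by (rule prob_space_distr) measurable
  interpret P: pair_prob_space "distr M borel S" "distr M borel Y" ..
  have lip_int: "integrable M (\<lambda>\<omega>. k (W \<omega>))"
    if k: "1-lipschitz_on UNIV k" and W: "integrable M W" for k :: "'b \<Rightarrow> real" and W
  proof (rule Bochner_Integration.integrable_bound)
    show "integrable M (\<lambda>\<omega>. \<bar>k 0\<bar> + norm (W \<omega>))" using W by simp
    have "k \<in> borel_measurable borel" using k by (rule lipschitz_borel_measurable)
    with W show "(\<lambda>\<omega>. k (W \<omega>)) \<in> borel_measurable M" by measurable
    have "\<bar>k w\<bar> \<le> \<bar>k 0\<bar> + norm w" for w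
      using lipschitz_on_normD[OF k, of w 0] by simp
    then show "AE \<omega> in M. norm (k (W \<omega>)) \<le> norm (\<bar>k 0\<bar> + norm (W \<omega>))"
      by (intro AE_I2) (simp add: abs_of_nonneg)
  qed
  have joint: "distr M borel S \<Otimes>\<^sub>M distr M borel Y = distr M (borel \<Otimes>\<^sub>M borel) (\<lambda>\<omega>. (S \<omega>, Y \<omega>))"
    using indep by (simp add: indep_var_distribution_eq)
  have int: "integrable (distr M borel S \<Otimes>\<^sub>M distr M borel Y) (\<lambda>(s, y). g (s + \<tau> *\<^sub>R y))"
    unfolding joint using lip_int[OF g, of "\<lambda>\<omega>. S \<omega> + \<tau> *\<^sub>R Y \<omega>"] S Y
    by (subst integrable_distr_eq) auto
  have "expectation (\<lambda>\<omega>. g (S \<omega> + \<tau> *\<^sub>R Y \<omega>)) =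
      (\<integral>p. (case p of (s, y) \<Rightarrow> g (s + \<tau> *\<^sub>R y)) \<partial>(distr M borel S \<Otimes>\<^sub>M distr M borel Y))"
    unfolding joint by (subst integral_distr) auto
  also have "\<dots> = (\<integral>s. \<integral>y. g (s + \<tau> *\<^sub>R y) \<partial>distr M borel Y \<partial>distr M borel S)"
    by (rule P.integral_fst[OF int, symmetric])
  finally have "expectation (\<lambda>\<omega>. g (S \<omega> + \<tau> *\<^sub>R Y \<omega>)) - expectation (\<lambda>\<omega>. g' (S \<omega>)) =
      (\<integral>s. (\<integral>y. g (s + \<tau> *\<^sub>R y) \<partial>distr M borel Y) - g' s \<partial>distr M borel S)"
    using P.integrable_fst[OF int] lip_int[OF g' S]
    by (subst Bochner_Integration.integral_diff) (auto simp: integral_distr integrable_distr_eq)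
  also have "\<bar>\<dots>\<bar> \<le> (\<integral>s. \<delta> \<partial>distr M borel S)"
    using P.integrable_fst[OF int] lip_int[OF g' S] bound
    by (intro order_trans[OF integral_abs_bound] integral_mono integrable_abs
        Bochner_Integration.integrable_diff) (auto simp: integrable_distr_eq)
  finally show ?thesis by (simp add: S.prob_space[simplified])
qed

lemma (in prob_space) lindeberg_bound:
  fixes X :: "nat \<Rightarrow> 'a \<Rightarrow> 'b::euclidean_space"
  assumes indep: "indep_vars (\<lambda>_. borel) X {1..}"
    and law: "\<And>j. 1 \<le> j \<Longrightarrow> distr M borel (X j) = \<nu>"
    and \<nu>: "isotropic_law \<nu>"
    and h: "1-lipschitz_on UNIV h" and n: "0 < n"
  shows "\<bar>expectation (\<lambda>\<omega>. h ((1 / sqrt n) *\<^sub>R (\<Sum>j=1..n. X j \<omega>))) - (\<integral>z. h z \<partial>std_gauss)\<bar>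
    \<le> (2 + 3 * harm (n - 1)) / sqrt n * (\<integral>y. norm y ^ 3 \<partial>\<nu>)"
proof -
  interpret \<nu>: isotropic_law \<nu> by fact
  define \<beta> where "\<beta> = (\<integral>y. norm y ^ 3 \<partial>\<nu>)"
  define \<tau> where "\<tau> = 1 / sqrt n"
  have \<tau>: "0 < \<tau>" using n by (simp add: \<tau>_def)
  define \<sigma> where "\<sigma> m = sqrt (real m / n)" for m
  define S where "S k \<omega> = \<tau> *\<^sub>R (\<Sum>j=1..k. X j \<omega>)" for k \<omega>
  \<comment> \<open>In \<open>a k\<close> the first \<open>k\<close> summands are genuine, and the
    \<open>n - k\<close> Gaussian ones are merged into a smoothing of variance (n - k) / n. So
    \<open>a 0\<close> is the Gaussian side and \<open>a n\<close> the normalised sum.\<close>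
  define a where "a k = expectation (\<lambda>\<omega>. gauss_smooth (\<sigma> (n - k)) h (S k \<omega>))" for k
  have X [measurable]: "random_variable borel (X j)" if "1 \<le> j" for j
    using indep that by (auto simp: indep_vars_def)
  have int_X: "integrable M (X j)" if "1 \<le> j" for j
  proof -
    have "integrable (distr M borel (X j)) norm"
      unfolding law[OF that] by (rule \<nu>.integrable_norm)
    then show ?thesis using X[OF that] by (simp add: integrable_distr_eq integrable_norm_iff)
  qed
  \<comment> \<open>The error of one exchange is left abstract, since the final replacement uses a
    different estimate from all others.\<close>
  have step: "\<bar>a (Suc k) - a k\<bar> \<le> \<delta>"
    if k: "k < n" and \<delta>: "\<And>x. \<bar>(\<integral>y. gauss_smooth (\<sigma> (n - Suc k)) h (x + \<tau> *\<^sub>R y) \<partial>\<nu>) -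
      (\<integral>z. gauss_smooth (\<sigma> (n - Suc k)) h (x + \<tau> *\<^sub>R z) \<partial>std_gauss)\<bar> \<le> \<delta>" for k \<delta>
  proof -
    \<comment> \<open>One Gaussian summand of size \<tau> is split off the smoothing; it is the one
      that X (Suc k) replaces.\<close>
    have "\<sigma> (n - k) ^ 2 = \<sigma> (n - Suc k) ^ 2 + \<tau>\<^sup>2"
      using k by (simp add: \<sigma>_def \<tau>_def power_divide real_sqrt_divide of_nat_diff flip: add_divide_distrib)
    moreover have "0 < \<sigma> (n - k)" using k by (simp add: \<sigma>_def)
    ultimately have semi: "(\<integral>z. gauss_smooth (\<sigma> (n - Suc k)) h (x + \<tau> *\<^sub>R z) \<partial>std_gauss) =
        gauss_smooth (\<sigma> (n - k)) h x" for x
      using gauss_smooth_semigroup[OF h \<tau>] by blast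
    have int_S: "integrable M (S k)"
      unfolding S_def[abs_def]
      by (intro integrable_scaleR_right Bochner_Integration.integrable_sum int_X) simp
    have "indep_vars (\<lambda>_. borel) X (insert (Suc k) {1..k})"
      using indep by (rule indep_vars_subset) auto
    then have "indep_var borel (\<lambda>\<omega>. \<Sum>j=1..k. X j \<omega>) borel (X (Suc k))"
      by (intro indep_vars_sum_euclidean) auto
    then have "indep_var borel ((\<lambda>s. \<tau> *\<^sub>R s) \<circ> (\<lambda>\<omega>. \<Sum>j=1..k. X j \<omega>)) borel ((\<lambda>y. y) \<circ> X (Suc k))"
      by (rule indep_var_compose) measurable
    moreover have "(\<lambda>s. \<tau> *\<^sub>R s) \<circ> (\<lambda>\<omega>. \<Sum>j=1..k. X j \<omega>) = S k" "(\<lambda>y. y) \<circ> X (Suc k) = X (Suc k)"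
      by (simp_all add: S_def fun_eq_iff)
    ultimately have "indep_var borel (S k) borel (X (Suc k))" by simp
    then have "\<bar>expectation (\<lambda>\<omega>. gauss_smooth (\<sigma> (n - Suc k)) h (S k \<omega> + \<tau> *\<^sub>R X (Suc k) \<omega>)) - a k\<bar> \<le> \<delta>"
      unfolding a_def using \<delta>
      by (intro lindeberg_step int_S int_X gauss_smooth_lipschitz[OF h]) (simp_all add: law semi)
    then show ?thesis by (simp add: a_def S_def scaleR_add_right)
  qed
  have smooth_step: "\<bar>a (Suc k) - a k\<bar> \<le> 3 * \<beta> * \<tau> / real (n - Suc k)" if k: "Suc k < n" for k
  proof (rule step)
    fix x
    have \<sigma>: "0 < \<sigma> (n - Suc k)" using k by (simp add: \<sigma>_def)
    \<comment> \<open>Here \<tau>^2 = 1/n and \<sigma>^2 = (n - Suc k)/n, so the factors of n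
      cancel.\<close>
    have "\<tau> ^ 3 / (\<sigma> (n - Suc k))\<^sup>2 = \<tau> / real (n - Suc k)"
      using k by (simp add: \<sigma>_def \<tau>_def power_divide power3_eq_cube real_sqrt_divide)
    then show "\<bar>(\<integral>y. gauss_smooth (\<sigma> (n - Suc k)) h (x + \<tau> *\<^sub>R y) \<partial>\<nu>) -
      (\<integral>z. gauss_smooth (\<sigma> (n - Suc k)) h (x + \<tau> *\<^sub>R z) \<partial>std_gauss)\<bar> \<le> 3 * \<beta> * \<tau> / real (n - Suc k)"
      using \<nu>.gauss_smooth_exchange[OF h \<sigma> \<tau>, of x] by (simp add: \<beta>_def mult_ac)
  qed (use k in simp)
  \<comment> \<open>For k = n - 1 no Gaussian summand is left to smooth with: \<sigma> is 0, and
    only the first-moment estimate applies.\<close>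
  have last_step: "\<bar>a n - a (n - 1)\<bar> \<le> 2 * \<beta> * \<tau>"
    using step[of "n - 1" "2 * \<beta> * \<tau>"] \<nu>.lipschitz_exchange[OF h \<tau>] n
    by (simp add: \<sigma>_def gauss_smooth_zero[OF h] \<beta>_def mult_ac)
  have "\<bar>a (n - 1) - a 0\<bar> = \<bar>\<Sum>k<n - 1. a (Suc k) - a k\<bar>"
    by (simp add: sum_lessThan_telescope)
  also have "\<dots> \<le> (\<Sum>k<n - 1. 3 * \<beta> * \<tau> / real (n - Suc k))"
    by (intro order_trans[OF sum_abs] sum_mono smooth_step) auto
  \<comment> \<open>Reversing the order of summation: \<open>n - Suc k\<close> runs from n - 1 down
    to 1.\<close>
  also have "\<dots> = (\<Sum>k<n - 1. 3 * \<beta> * \<tau> / real (Suc k))"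
    by (subst sum.nat_diff_reindex[symmetric], rule sum.cong) (auto simp: Suc_diff_Suc)
  also have "\<dots> = 3 * \<beta> * \<tau> * harm (n - 1)"
    by (simp add: harm_altdef sum_distrib_left divide_inverse)
  finally have "\<bar>a n - a 0\<bar> \<le> 2 * \<beta> * \<tau> + 3 * \<beta> * \<tau> * harm (n - 1)"
    using last_step by linarith
  moreover have "a n = expectation (\<lambda>\<omega>. h ((1 / sqrt n) *\<^sub>R (\<Sum>j=1..n. X j \<omega>)))"
    by (simp add: a_def S_def \<tau>_def \<sigma>_def gauss_smooth_zero[OF h])
  moreover have "a 0 = (\<integral>z. h z \<partial>std_gauss)"
    using n by (simp add: a_def S_def \<sigma>_def gauss_smooth_def prob_space)
  ultimately show ?thesis
    by (simp add: \<beta>_def \<tau>_def add_divide_distrib distrib_left mult_ac)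
qed

section \<open>From the replacement bound to the stated constant\<close>

lemma C_const_nonneg: "0 \<le> C_const d"
proof (cases "d = 0")
  case False
  then show ?thesis
    unfolding C_const_def
    by (intro add_nonneg_nonneg mult_nonneg_nonneg divide_nonneg_nonneg less_imp_le[OF Gamma_real_pos]) auto
qed (simp add: C_const_def)

theorem corollary1p2:
  fixes M :: "'a measure" and N :: "'b measure"
    and X :: "nat \<Rightarrow> 'a \<Rightarrow> real ^ 'd" and Z :: "'b \<Rightarrow> real ^ 'd"
    and n i :: nat
  assumes M: "prob_space M" and N: "prob_space N"
    and indep: "prob_space.indep_vars M (\<lambda>_. borel) X {1..}"
    and ident: "\<And>j. j \<ge> 1 \<Longrightarrow> distr M borel (X j) = distr M borel (X 1)"
    and centered: "(\<integral>\<omega>. X 1 \<omega> \<partial>M) = 0"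
    and unit_cov: "(\<integral>\<omega>. (\<chi> j k. X 1 \<omega> $ j * X 1 \<omega> $ k) \<partial>M) = (mat 1 :: real ^ 'd ^ 'd)"
    and third_moment: "integrable M (\<lambda>\<omega>. norm (X 1 \<omega>) ^ 3)"
    and Z: "distributed N lborel Z (\<lambda>x. ennreal (std_normal_vec_density x))"
    and n: "n \<ge> 3" and i: "i \<ge> 1"
  shows "wasserstein (distr M borel (\<lambda>\<omega>. (1 / sqrt (real n)) *\<^sub>R (\<Sum>j=1..n. X j \<omega>)))
                     (distr N borel Z)
         \<le> ereal (exp 1 * ((C_const CARD('d) + 2 * (1 + real CARD('d)) * ln (real n)) / sqrt (real n))
                  * (\<integral>\<omega>. norm (X i \<omega>) ^ 3 \<partial>M))"
proof -
  interpret prob_space M by fact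
  define \<nu> where "\<nu> = distr M borel (X 1)"
  have X [measurable]: "random_variable borel (X j)" if "1 \<le> j" for j
    using indep that by (auto simp: indep_vars_def)
  have [measurable]: "random_variable borel (X 1)" by (rule X) simp
  have int_X: "integrable M (X 1)"
  proof (rule Bochner_Integration.integrable_bound)
    show "integrable M (\<lambda>\<omega>. 1 + norm (X 1 \<omega>) ^ 3)" using third_moment by simp
    show "AE \<omega> in M. norm (X 1 \<omega>) \<le> norm (1 + norm (X 1 \<omega>) ^ 3)"
      using le_one_plus_cube by (intro AE_I2) (simp add: abs_of_nonneg)
  qed measurable
  have coord: "expectation (\<lambda>\<omega>. X 1 \<omega> $ j * X 1 \<omega> $ k) = of_bool (j = k)" for j k
  proof -
    let ?A = "\<lambda>\<omega>. (\<chi> j k. X 1 \<omega> $ j * X 1 \<omega> $ k)"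
    \<comment> \<open>Integrability is extracted from \<open>unit_cov\<close> itself: a
      non-integrable matrix would have Bochner integral 0, which is not the identity.\<close>
    have "integrable M ?A"
    proof (rule ccontr)
      assume "\<not> integrable M ?A"
      then have "mat 1 = (0 :: real ^ 'd ^ 'd)"
        using unit_cov by (simp add: not_integrable_integral_eq)
      then have "(mat 1 :: real ^ 'd ^ 'd) $ j $ j = 0" by simp
      then show False by (simp add: mat_def)
    qed
    then have "(\<integral>\<omega>. ?A \<omega> $ j $ k \<partial>M) = (\<integral>\<omega>. ?A \<omega> \<partial>M) $ j $ k"
      by (intro integral_bounded_linear[of "\<lambda>A. A $ j $ k"]
          bounded_linear_compose[OF bounded_linear_vec_nth bounded_linear_vec_nth])
    then show ?thesis unfolding unit_cov by (simp add: mat_def)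
  qed
  have iso: "isotropic_law \<nu>"
    unfolding \<nu>_def
  proof (intro isotropic_law.intro isotropic_law_axioms.intro)
    show "prob_space (distr M borel (X 1))" by (rule prob_space_distr) simp
    show "integrable (distr M borel (X 1)) (\<lambda>y. norm y ^ 3)"
      using third_moment by (simp add: integrable_distr_eq)
    show "(\<integral>y. y \<bullet> b \<partial>distr M borel (X 1)) = 0" for b
      using int_X centered by (simp add: integral_distr)
    show "(\<integral>y. (y \<bullet> b) * (y \<bullet> c) \<partial>distr M borel (X 1)) = of_bool (b = c)"
      if bc: "b \<in> Basis" "c \<in> Basis" for b c
    proof -
      obtain j k where "b = axis j 1" "c = axis k 1"
        using bc by (auto simp: Basis_vec_def)
      then show ?thesis
        using coord[of j k] by (simp add: integral_distr inner_axis axis_eq_axis)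
    qed
  qed simp
  have law: "distr M borel (X j) = \<nu>" if "1 \<le> j" for j
    using ident[OF that] by (simp add: \<nu>_def)
  have Z_law: "distr N borel Z = std_gauss"
  proof -
    have "(std_normal_vec_density :: real ^ 'd \<Rightarrow> real) = gauss_density"
      by (simp add: fun_eq_iff std_normal_vec_density_def gauss_density_def)
    then have "distr N lborel Z = std_gauss"
      using distributed_distr_eq_density[OF Z] by (simp add: std_gauss_def)
    then show ?thesis by (simp cong: distr_cong)
  qed
  define \<beta> where "\<beta> = expectation (\<lambda>\<omega>. norm (X i \<omega>) ^ 3)"
  have \<beta>: "\<beta> = (\<integral>y. norm y ^ 3 \<partial>\<nu>)" "0 \<le> \<beta>"
    using i by (simp_all add: \<beta>_def integral_distr flip: law[OF i])
  \<comment> \<open>Uses e \<le> 3 \<le> n.\<close>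
  have ln_n: "1 \<le> ln (real n)"
    using n exp_le by (subst ln_ge_iff) auto
  have "harm (n - 1) \<le> (harm n :: real)" by (intro harm_mono) simp
  \<comment> \<open>The sequence H_n - ln n decreases from its value 1 at n = 1.\<close>
  moreover have "harm n \<le> 1 + ln (real n)"
    using euler_mascheroni_sequence_decreasing[of 1 n] n by (simp add: harm_expand)
  \<comment> \<open>The left side is at most 5 + 3 ln n, and 5 \<le> 5 ln n.\<close>
  ultimately have "2 + 3 * harm (n - 1) \<le> 8 * ln (real n)"
    using ln_n by linarith
  \<comment> \<open>Only e \<ge> 2 enters; the next step uses 4 \<le> 2 (1 + d), that is d \<ge>
    1.\<close>
  also have "\<dots> \<le> exp 1 * (4 * ln (real n))"
    using ln_n exp_ge_add_one_self[of 1] by simp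
  also have "\<dots> \<le> exp 1 * (C_const CARD('d) + 2 * (1 + real CARD('d)) * ln (real n))"
  proof (intro mult_left_mono)
    have "(4 :: real) * ln n \<le> (2 * (1 + real CARD('d))) * ln n"
      using ln_n by (intro mult_right_mono) (auto simp: Suc_le_eq)
    then show "4 * ln (real n) \<le> C_const CARD('d) + 2 * (1 + real CARD('d)) * ln (real n)"
      using C_const_nonneg[of "CARD('d)"] by linarith
  qed simp
  finally have bound: "(2 + 3 * harm (n - 1)) / sqrt n * \<beta> \<le>
      exp 1 * ((C_const CARD('d) + 2 * (1 + real CARD('d)) * ln (real n)) / sqrt n) * \<beta>"
    using \<beta>(2) by (simp add: divide_right_mono mult_right_mono)
  show ?thesis
    unfolding wasserstein_def Z_law \<beta>_def[symmetric]
  proof (rule SUP_least)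
    fix h :: "real ^ 'd \<Rightarrow> real"
    assume "h \<in> {h. 1-lipschitz_on UNIV h}"
    then have h: "1-lipschitz_on UNIV h" by simp
    have [measurable]: "h \<in> borel_measurable borel" using h by (rule lipschitz_borel_measurable)
    have "(\<lambda>\<omega>. (1 / sqrt n) *\<^sub>R (\<Sum>j=1..n. X j \<omega>)) \<in> borel_measurable M"
      by (intro borel_measurable_scaleR borel_measurable_const borel_measurable_sum X) auto
    then have "(\<integral>x. h x \<partial>distr M borel (\<lambda>\<omega>. (1 / sqrt n) *\<^sub>R (\<Sum>j=1..n. X j \<omega>))) =
        expectation (\<lambda>\<omega>. h ((1 / sqrt n) *\<^sub>R (\<Sum>j=1..n. X j \<omega>)))"
      by (rule integral_distr) measurable
    with lindeberg_bound[OF indep law iso h, of n] bound n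
    show "ereal ((\<integral>x. h x \<partial>distr M borel (\<lambda>\<omega>. (1 / sqrt n) *\<^sub>R (\<Sum>j=1..n. X j \<omega>))) - (\<integral>x. h x \<partial>std_gauss))
      \<le> ereal (exp 1 * ((C_const CARD('d) + 2 * (1 + real CARD('d)) * ln (real n)) / sqrt n) * \<beta>)"
      by (simp add: \<beta>(1) abs_le_iff)
  qed
qed

end
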